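(* Let $\mu$ be a singular Borel probability measure on $\mathbb{T}=(-1/2,1/2)$, let $b$ be the inner function associated to $\mu$ by the Herglotz representation, and let $\mu_{+}(z)=\int_{\mathbb{T}}\frac{1}{1-ze^{-2\pi i x}}\,d\mu(x)$. Let $F$ be an entire function. Then there exists $f\in L^2(\mu)$ such that $$F(z)=\int_{\mathbb{T}} f(x)e^{-2\pi i x z}\,d\mu(x)\qquad\text{for all } z\in\mathbb{C}$$ if and only if all of the following hold: (i) there is a function $\varepsilon:[0,\infty)\to[0,\infty)$ with $\varepsilon(r)=o(1)$ as $r\to\infty$ such that $|F(z)|\le\varepsilon(|z|)e^{\pi|z|}$ for all $z\in\mathbb{C}$; (ii) the following inclusions hold: $$G_{+}(z):=\frac{\sum_{n=0}^{\infty}F(n)z^n}{\mu_{+}(z)}\in\mathcal{H}(b),\qquad G_{-}(z):=\frac{\sum_{n=0}^{\infty}\overline{F(-n)}z^n}{\mu_{+}(z)}\in\mathcal{H}(b);$$ (iii) the $L^2(\mu)$-boundaries of $G_{+}$ and $G_{-}$ satisfy $\overline{G_{+}^{\star}}=G_{-}^{\star}$ (as elements of $L^2(\mu)$).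
   Context: The circle $\mathbb{T}$ is identified with $(-1/2,1/2)$ via $x\mapsto e^{2\pi i x}$; it is a standing assumption that $\mu$ gives no mass to the point $1/2$ of the circle. "Singular" means singular with respect to Lebesgue measure. $\mathbb{D}$ is the open unit disc and $H^2=H^2(\mathbb{D})$ the Hardy space. The inner function $b$ associated to $\mu$ by the Herglotz representation is the unique inner function on $\mathbb{D}$ with $\frac{1+b(z)}{1-b(z)}=\int_{\mathbb{T}}\frac{e^{2\pi i x}+z}{e^{2\pi i x}-z}\,d\mu(x)$ for $z\in\mathbb{D}$ (equivalently $\mu_{+}=1/(1-b)$; here $b(0)=0$). The model space is $\mathcal{H}(b)=H^2\ominus bH^2$, the orthogonal complement of $bH^2$ in $H^2$. The function $\mu_{+}$ is analytic and nonvanishing on $\mathbb{D}$. If $1/\mu_{+}(z)=\sum_{n\ge0}\alpha_n z^n$ and $\{a_n\}_{n\ge 0}$ is a sequence of complex numbers, then $\frac{\sum_n a_nz^n}{\mu_{+}(z)}$ is understood as the power series $\sum_{n\ge0}\left(\sum_{j=0}^n\alpha_{n-j}a_j\right)z^n$, and its membership in $\mathcal{H}(b)$ means that this is the Taylor series of an element of $\mathcal{H}(b)$. The Normalized Cauchy transform is $V_\mu:L^2(\mu)\to\mathcal{H}(b)$, $V_\mu f(z)=\frac{1}{\mu_{+}(z)}\int_{\mathbb{T}}\frac{f(x)}{1-ze^{-2\pi i x}}\,d\mu(x)$; by a theorem of Clark it is a unitary operator. For $G\in\mathcal{H}(b)$, its $L^2(\mu)$-boundary $G^{\star}$ is the unique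 $f\in L^2(\mu)$ with $V_\mu f=G$ (by a theorem of Poltoratskiĭ, $\lim_{r\to1^-}\|f(x)-G(re^{2\pi i x})\|_{L^2(\mu)}=0$). *)

theory Defs
  imports "HOL-Probability.Probability_Measure" "HOL-Complex_Analysis.Complex_Analysis"
begin

text \<open>
  The circle is identified with the open interval \<open>(-1/2, 1/2)\<close> via \<open>x \<mapsto> cis (2 * pi * x)\<close>;
  a measure on it is a measure on the Borel sets of this interval. In particular, it has no mass
  at the point \<open>1/2\<close>.
\<close>

definition circle_borel :: "real measure" where
  "circle_borel = restrict_space borel {-1/2<..<1/2}"

definition singular_to_lebesgue :: "real measure \<Rightarrow> bool" where
  "singular_to_lebesgue \<mu> \<longleftrightarrow> (\<exists>N\<in>sets \<mu>. emeasure lborel N = 0 \<and> emeasure \<mu> (space \<mu> - N) = 0)"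

text \<open>Elements of \<open>L2 \<mu>\<close> are functions, not classes; equality in \<open>L\<^sup>2(\<mu>)\<close> is \<open>\<mu>\<close>-a.e. equality.\<close>

definition L2 :: "real measure \<Rightarrow> (real \<Rightarrow> complex) set" where
  "L2 \<mu> = {f \<in> borel_measurable \<mu>. integrable \<mu> (\<lambda>x. (norm (f x))\<^sup>2)}"

text \<open>
  Functions on the unit disc are total functions of which only the values on \<open>ball 0 1\<close> matter.
  The Hardy space \<open>H\<^sup>2\<close> consists of the holomorphic functions on the disc with square summable
  Taylor coefficients at \<open>0\<close>, with the \<open>\<ell>\<^sup>2\<close> inner product of the coefficients.
\<close>

definition hardy_space :: "(complex \<Rightarrow> complex) set" where
  "hardy_space = {G. G holomorphic_on ball 0 1 \<and>
      summable (\<lambda>n. (norm (fps_nth (fps_expansion G 0) n))\<^sup>2)}"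

definition hardy_inner :: "(complex \<Rightarrow> complex) \<Rightarrow> (complex \<Rightarrow> complex) \<Rightarrow> complex" where
  "hardy_inner G H =
     (\<Sum>n. fps_nth (fps_expansion G 0) n * cnj (fps_nth (fps_expansion H 0) n))"

definition inner_function :: "(complex \<Rightarrow> complex) \<Rightarrow> bool" where
  "inner_function b \<longleftrightarrow> b holomorphic_on ball 0 1 \<and> (\<forall>z\<in>ball 0 1. norm (b z) \<le> 1) \<and>
     (AE t in lborel. t \<in> {-1/2<..<1/2} \<longrightarrow>
        (\<exists>w. norm w = 1 \<and>
             ((\<lambda>r. b (complex_of_real r * cis (2 * pi * t))) \<longlongrightarrow> w) (at_left 1)))"

text \<open>
  If \<open>\<mu>\<close> is a probability measure, the right-hand side below is \<open>1\<close> at \<open>z = 0\<close>; by the maximum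
  principle an inner function satisfying the identity never takes the value \<open>1\<close> on the disc,
  so that the division is a genuine one.
\<close>

definition herglotz_inner :: "real measure \<Rightarrow> (complex \<Rightarrow> complex) \<Rightarrow> bool" where
  "herglotz_inner \<mu> b \<longleftrightarrow> inner_function b \<and>
     (\<forall>z\<in>ball 0 1. (1 + b z) / (1 - b z) =
        (\<integral>x. (cis (2 * pi * x) + z) / (cis (2 * pi * x) - z) \<partial>\<mu>))"

definition model_space :: "(complex \<Rightarrow> complex) \<Rightarrow> (complex \<Rightarrow> complex) set" where
  "model_space b = {G \<in> hardy_space. \<forall>H\<in>hardy_space. hardy_inner G (\<lambda>z. b z * H z) = 0}"

definition mu_plus :: "real measure \<Rightarrow> complex \<Rightarrow> complex" where
  "mu_plus \<mu> z = (\<integral>x. 1 / (1 - z * cis (- (2 * pi * x))) \<partial>\<mu>)"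

definition normalized_cauchy :: "real measure \<Rightarrow> (real \<Rightarrow> complex) \<Rightarrow> complex \<Rightarrow> complex" where
  "normalized_cauchy \<mu> f z =
     1 / mu_plus \<mu> z * (\<integral>x. f x / (1 - z * cis (- (2 * pi * x))) \<partial>\<mu>)"

text \<open>A representative; by Clark's theorem it exists for \<open>G\<close> in the model space, and is unique up to
  \<open>\<mu>\<close>-null sets.\<close>

definition L2_boundary :: "real measure \<Rightarrow> (complex \<Rightarrow> complex) \<Rightarrow> real \<Rightarrow> complex" where
  "L2_boundary \<mu> G = (SOME f. f \<in> L2 \<mu> \<and> (\<forall>z\<in>ball 0 1. normalized_cauchy \<mu> f z = G z))"

text \<open>The formal power series \<open>(\<Sum>n. a n * z ^ n) / mu_plus \<mu> z\<close>, a Cauchy product of coefficient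
  sequences; no convergence of \<open>\<Sum>n. a n * z ^ n\<close> is required.\<close>

definition series_over_mu_plus :: "real measure \<Rightarrow> (nat \<Rightarrow> complex) \<Rightarrow> complex fps" where
  "series_over_mu_plus \<mu> a = Abs_fps a * fps_expansion (\<lambda>z. 1 / mu_plus \<mu> z) 0"

end

theory Submission
  imports Defs "HOL-Real_Asymp.Real_Asymp"
begin

text \<open>
  Write \<open>b = \<Sum>n. \<beta> n * z ^ n\<close>. The Taylor coefficients of the normalized Cauchy transform of \<open>f\<close> are the
  inner products of \<open>f\<close> with trigonometric polynomials \<open>u n\<close>, and the Herglotz representation says
  that the Gram matrix of the \<open>u n\<close> is \<open>I - (T T\<^sup>*)\<close>, up to conjugation, where \<open>T\<close> is the lower triangular
  Toeplitz matrix of multiplication by \<open>b\<close>. Together with \<open>\<Sum>n. (norm (\<beta> n))\<^sup>2 = 1\<close>, which is Parseval's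
  identity for the inner function \<open>b\<close>, this gives Clark's theorem: the range of the transform is the model
  space, and a function with vanishing nonnegative Fourier coefficients is null, because the
  transform of \<open>cis (- 2 * pi * x)\<close> is \<open>b z / z\<close>, so that this character lies in the closed span of the
  \<open>u n\<close>, and then so do all the others.

  Conditions (ii) and (iii) thus say that \<open>F\<close> agrees at the integers with the Fourier
  transform of some \<open>f \<in> L2 \<mu>\<close>. That transform satisfies (i) because \<open>\<mu>\<close> lives on the open interval,
  and a form of Carlson's theorem shows that an entire function satisfying (i) is determined by its values
  at the integers.
\<close>

section \<open>Entire functions of exponential type\<close>

text \<open>Let V be the map \<open>f \<mapsto> clark_coeff f\<close> and V' its adjoint, which
  sends a sequence \<open>a\<close> to the series with terms \<open>a n * u n x\<close>. The Gram
  identity says V V' = I - T T'. So V V' is the identity on the kernel of T', which is the model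
  space, and V' supplies preimages there. Innerness of b means T' T = I; only the diagonal of this,
  \<open>\<beta>_sums\<close>, has to be proved, because a contraction T whose columns have norm 1
  satisfies the rest. Everything is done with finite sections: T is lower triangular, so the Gram
  identity is exact for indices up to any N, and only the limits over N need an argument. V sees
  only the nonnegative Fourier coefficients. Hence the negative integers need a second function, and
  (iii) has to tie it to the first. In (i), the decay of \<epsilon> excludes the multiples of sin(pi
  z), which vanish at the integers and grow like exp(pi |z|) on the imaginary axis. Carlson's
  theorem serves twice: for the final uniqueness, and for passing from vanishing Fourier
  coefficients to vanishing moments.\<close>

text \<open>A sector of opening 2 \<theta> < pi leaves room for an exponent \<beta> > 1 with \<beta>
  \<theta> < pi / 2. Then exp(- \<eta> z^\<beta>) decays in the whole sector faster than any
  exponential of |z|, and \<eta> tends to 0 at the end.\<close>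

lemma phragmen_lindelof_sector:
  fixes f :: "complex \<Rightarrow> complex"
  assumes hol: "f holomorphic_on UNIV" and \<theta>: "0 < \<theta>" "\<theta> < pi / 2"
    and growth: "\<And>z. norm (f z) \<le> A * exp (B * norm z)"
    and rays: "\<And>r. r > 0 \<Longrightarrow> norm (f (of_real r * cis \<theta>)) \<le> M"
      "\<And>r. r > 0 \<Longrightarrow> norm (f (of_real r * cis (- \<theta>))) \<le> M"
    and "r > 0" "\<bar>t\<bar> \<le> \<theta>"
  shows "norm (f (of_real r * cis t)) \<le> M"
proof -
  \<comment> \<open>Midpoint of 1 and pi / (2 \<theta>): above 1 to beat exponential growth, below
    pi / (2 \<theta>) to keep z^\<beta> in the right half-plane.\<close>
  define \<beta> where "\<beta> = (1 + pi / (2 * \<theta>)) / 2"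
  have "pi / (2 * \<theta>) > 1"
    using \<theta> by (simp add: field_simps)
  then have \<beta>: "\<beta> > 1"
    by (simp add: \<beta>_def)
  have \<beta>\<theta>: "0 < \<beta> * \<theta>" "\<beta> * \<theta> < pi / 2"
  proof -
    show "0 < \<beta> * \<theta>"
      using \<theta> \<beta> by simp
    have "\<beta> * \<theta> = \<theta> / 2 + pi / 4"
      using \<theta> by (simp add: \<beta>_def field_simps)
    then show "\<beta> * \<theta> < pi / 2"
      using \<theta> by simp
  qed
  define c where "c = cos (\<beta> * \<theta>)"
  have c: "c > 0"
    unfolding c_def using \<beta>\<theta> by (intro cos_gt_zero_pi) auto
  have cosge: "cos (\<beta> * s) \<ge> c" if "\<bar>s\<bar> \<le> \<theta>" for s
  proof -
    have "cos (\<beta> * s) = cos (\<beta> * \<bar>s\<bar>)"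
      by (simp add: abs_if)
    also have "\<dots> \<ge> c"
      unfolding c_def using that \<beta> \<beta>\<theta> by (intro cos_monotone_0_pi_le) auto
    finally show ?thesis .
  qed
  have A: "0 \<le> A"
    using order_trans[OF norm_ge_zero growth[of 0]] by simp
  have M: "0 \<le> M"
    using rays(1)[of 1] norm_ge_zero[of "f (of_real 1 * cis \<theta>)"] by linarith
  have fcont: "isCont f z" for z
    using hol by (metis UNIV_I continuous_on_eq_continuous_at holomorphic_on_imp_continuous_on open_UNIV)
  \<comment> \<open>The vertex is on neither ray with r > 0. Its value is needed for the left edge
    of the rectangle below, which corresponds to a small arc around the vertex.\<close>
  have f0: "norm (f 0) \<le> M"
  proof (rule tendsto_upperbound)
    show "((\<lambda>r. norm (f (of_real r * cis \<theta>))) \<longlongrightarrow> norm (f 0)) (at_right 0)"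
    proof (intro tendsto_norm isCont_tendsto_compose[OF fcont])
      show "((\<lambda>r. complex_of_real r * cis \<theta>) \<longlongrightarrow> 0) (at_right 0)"
        by (auto intro!: tendsto_eq_intros)
    qed
    show "\<forall>\<^sub>F r in at_right 0. norm (f (of_real r * cis \<theta>)) \<le> M"
      using rays(1) by (auto simp: eventually_at_filter)
  qed auto
  define w0 where "w0 = Complex (ln r) t"
  have expw0: "exp w0 = of_real r * cis t"
    using \<open>r > 0\<close> by (simp add: w0_def exp_eq_polar exp_of_real[symmetric])
  have key: "norm (f (exp w0) * exp (- of_real \<eta> * exp (of_real \<beta> * w0))) \<le> M + e"
    if "\<eta> > 0" "e > 0" for \<eta> e
  proof -
    \<comment> \<open>In the coordinate w = log z the sector is a strip, and z^\<beta> becomes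
      exp(\<beta> w) without a choice of branch.\<close>
    define h where "h = (\<lambda>w. f (exp w) * exp (- of_real \<eta> * exp (of_real \<beta> * w)))"
    have hn: "norm (h w) = norm (f (exp w)) * exp (- \<eta> * (exp (\<beta> * Re w) * cos (\<beta> * Im w)))" for w
      by (simp add: h_def norm_mult Re_exp)
    have hholo: "h holomorphic_on UNIV"
    proof -
      have "(f \<circ> exp) holomorphic_on UNIV"
        by (intro holomorphic_on_compose holomorphic_on_exp holomorphic_on_subset[OF hol]) auto
      then show ?thesis
        unfolding h_def o_def by (intro holomorphic_intros)
    qed
    have "((\<lambda>L::real. A * exp (B * exp L - \<eta> * c * exp (\<beta> * L))) \<longlongrightarrow> 0) at_top"
    proof -
      have "filterlim (\<lambda>L::real. exp L * (\<eta> * c * exp ((\<beta> - 1) * L) - B)) at_top at_top"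
      proof (rule filterlim_at_top_mult_at_top)
        show "filterlim (exp :: real \<Rightarrow> real) at_top at_top"
          by (rule exp_at_top)
        have "filterlim (\<lambda>L. (\<beta> - 1) * L) at_top at_top"
          using \<beta> by (intro filterlim_tendsto_pos_mult_at_top[OF tendsto_const _ filterlim_ident]) auto
        then have "filterlim (\<lambda>L. exp ((\<beta> - 1) * L)) at_top at_top"
          by (rule filterlim_compose[OF exp_at_top])
        then have "filterlim (\<lambda>L. \<eta> * c * exp ((\<beta> - 1) * L)) at_top at_top"
          using \<open>\<eta> > 0\<close> c by (intro filterlim_tendsto_pos_mult_at_top[OF tendsto_const]) auto
        from filterlim_tendsto_add_at_top[OF tendsto_const this, of "-B"]
        show "filterlim (\<lambda>L. \<eta> * c * exp ((\<beta> - 1) * L) - B) at_top at_top"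
          by simp
      qed
      then have "((\<lambda>L::real. exp (- (exp L * (\<eta> * c * exp ((\<beta> - 1) * L) - B)))) \<longlongrightarrow> 0) at_top"
        by (intro filterlim_compose[OF exp_at_bot]) (simp add: filterlim_uminus_at_top)
      moreover have "- (exp L * (\<eta> * c * exp ((\<beta> - 1) * L) - B)) = B * exp L - \<eta> * c * exp (\<beta> * L)" for L
        by (simp add: algebra_simps exp_add[symmetric])
      ultimately show ?thesis
        by (auto intro: tendsto_mult_right_zero)
    qed
    then have "\<forall>\<^sub>F L in at_top. A * exp (B * exp L - \<eta> * c * exp (\<beta> * L)) < e"
      using \<open>e > 0\<close> by (rule order_tendstoD)
    moreover have "\<forall>\<^sub>F L in at_top. L \<ge> Re w0"
      by (rule eventually_ge_at_top)
    ultimately have "\<exists>L. A * exp (B * exp L - \<eta> * c * exp (\<beta> * L)) < e \<and> L \<ge> Re w0"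
      by (metis (mono_tags, lifting) eventually_happens' trivial_limit_at_top_linorder eventually_conj)
    then obtain L where L: "A * exp (B * exp L - \<eta> * c * exp (\<beta> * L)) < e" "L \<ge> Re w0"
      by blast
    obtain d where d: "d > 0" "\<And>z. norm z < d \<Longrightarrow> norm (f z) < M + e"
    proof -
      have "((\<lambda>z. norm (f z)) \<longlongrightarrow> norm (f 0)) (nhds 0)"
        using fcont[of 0] by (intro tendsto_norm) (simp add: continuous_at tendsto_at_iff_tendsto_nhds)
      then have "\<forall>\<^sub>F z in nhds 0. norm (f z) < M + e"
        using f0 \<open>e > 0\<close> by (intro order_tendstoD) auto
      then show ?thesis
        using that by (auto simp: eventually_nhds_metric)
    qed
    \<comment> \<open>Far enough to the left that |exp w| \<le> d / 2 on this edge, and not to the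
      right of w0, which must lie in the rectangle.\<close>
    define K where "K = min (Re w0) (ln (d / 2))"
    define S where "S = cbox (Complex K (- \<theta>)) (Complex L \<theta>)"
    have expK: "norm (exp w) < d" if "Re w = K" for w
    proof -
      have "exp K \<le> exp (ln (d / 2))"
        by (simp add: K_def)
      then show ?thesis
        using that d by simp
    qed
    have "norm (h w0) \<le> M + e"
    proof (rule maximum_modulus_frontier[of h S])
      show "h holomorphic_on interior S"
        using hholo by (rule holomorphic_on_subset) auto
      show "continuous_on (closure S) h"
        using hholo by (intro holomorphic_on_imp_continuous_on holomorphic_on_subset[OF hholo]) auto
      show "bounded S"
        by (simp add: S_def bounded_cbox)
      show "w0 \<in> S"
        using L(2) \<open>\<bar>t\<bar> \<le> \<theta>\<close> by (auto simp: S_def in_cbox_complex_iff K_def w0_def)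
      fix z assume "z \<in> frontier S"
      then have z: "z \<in> S" "z \<notin> interior S"
        by (auto simp: frontier_def S_def)
      then have zb: "K \<le> Re z" "Re z \<le> L" "\<bar>Im z\<bar> \<le> \<theta>"
        by (auto simp: S_def in_cbox_complex_iff)
      from z(2) have "\<not> (K < Re z \<and> Re z < L \<and> - \<theta> < Im z \<and> Im z < \<theta>)"
        by (simp add: S_def interior_cbox in_box_complex_iff)
      with zb have edges: "Re z = K \<or> Re z = L \<or> Im z = \<theta> \<or> Im z = - \<theta>"
        by linarith
      have pos: "0 \<le> \<eta> * (exp (\<beta> * Re z) * cos (\<beta> * Im z))"
        using \<open>\<eta> > 0\<close> cosge[OF zb(3)] c by (intro mult_nonneg_nonneg) auto
      then have hf: "norm (h z) \<le> norm (f (exp z))"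
        unfolding hn by (intro mult_left_le) auto
      have ez: "exp z = of_real (exp (Re z)) * cis (Im z)"
        by (simp add: exp_eq_polar)
      show "norm (h z) \<le> M + e"
        using edges
      proof (elim disjE)
        assume "Re z = K"
        from d(2)[OF expK[OF this]] hf show ?thesis
          by linarith
      next
        assume R: "Re z = L"
        have "norm (h z) \<le> A * exp (B * exp L) * exp (- \<eta> * (exp (\<beta> * L) * cos (\<beta> * Im z)))"
          unfolding hn R using growth[of "exp z"] R by (intro mult_right_mono) auto
        also have "\<dots> \<le> A * exp (B * exp L) * exp (- \<eta> * (exp (\<beta> * L) * c))"
          using A cosge[OF zb(3)] \<open>\<eta> > 0\<close> by (intro mult_left_mono) auto
        also have "\<dots> = A * exp (B * exp L - \<eta> * c * exp (\<beta> * L))"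
          by (simp add: exp_diff exp_minus field_simps)
        finally show ?thesis
          using L M by linarith
      next
        assume "Im z = \<theta>"
        with rays(1)[of "exp (Re z)"] hf ez \<open>e > 0\<close> show ?thesis
          by simp
      next
        assume "Im z = - \<theta>"
        with rays(2)[of "exp (Re z)"] hf ez \<open>e > 0\<close> show ?thesis
          by simp
      qed
    qed
    then show ?thesis
      by (simp add: h_def)
  qed
  have "norm (f (exp w0)) \<le> M"
  proof (rule tendsto_upperbound)
    show "((\<lambda>\<eta>. norm (f (exp w0) * exp (- of_real \<eta> * exp (of_real \<beta> * w0)))) \<longlongrightarrow> norm (f (exp w0))) (at_right 0)"
    proof -
      have "((\<lambda>\<eta>. norm (f (exp w0) * exp (- of_real \<eta> * exp (of_real \<beta> * w0))))
          \<longlongrightarrow> norm (f (exp w0) * exp (- of_real 0 * exp (of_real \<beta> * w0)))) (at_right 0)"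
        by (rule tendsto_norm tendsto_mult tendsto_exp tendsto_const tendsto_minus tendsto_of_real tendsto_ident_at)+
      then show ?thesis
        by simp
    qed
    show "\<forall>\<^sub>F \<eta> in at_right 0. norm (f (exp w0) * exp (- of_real \<eta> * exp (of_real \<beta> * w0))) \<le> M"
      using eventually_at_right_less
    proof eventually_elim
      case (elim \<eta>)
      show ?case
        by (rule field_le_epsilon, rule key[OF elim])
    qed
  qed auto
  then show ?thesis
    by (simp add: expw0)
qed

text \<open>The zeros of sin(pi z) are exactly the integers and are simple, so the quotient has
  removable singularities; l'Hopital's rule gives its values there.\<close>

lemma divide_by_sin_pi:
  fixes H :: "complex \<Rightarrow> complex"
  assumes hol: "H holomorphic_on UNIV" and zero: "\<And>n::int. H (of_int n) = 0"
  obtains g where "g holomorphic_on UNIV" "\<And>z. H z = g z * sin (of_real pi * z)"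
proof -
  define s where "s = (\<lambda>z::complex. sin (of_real pi * z))"
  have s0: "s z = 0 \<longleftrightarrow> z \<in> \<int>" for z
  proof -
    have "s z = 0 \<longleftrightarrow> (\<exists>n::int. of_real pi * z = of_real (of_int n * pi))"
      by (simp add: s_def sin_eq_0)
    also have "\<dots> \<longleftrightarrow> (\<exists>n::int. z = of_int n)"
      by (simp add: mult.commute)
    finally show ?thesis
      by (auto simp: Ints_def)
  qed
  have sd: "(s has_field_derivative of_real pi * cos (of_real pi * z)) (at z)" for z :: complex
    unfolding s_def by (auto intro!: derivative_eq_intros)
  have sd0: "of_real pi * cos (of_real pi * z) \<noteq> 0" if "z \<in> \<int>" for z :: complex
  proof -
    have "s z = 0"
      using that s0 by simp
    then have "(cos (of_real pi * z))\<^sup>2 = 1"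
      using sin_cos_squared_add[of "of_real pi * z"] by (simp add: s_def)
    then show ?thesis
      by auto
  qed
  define g where "g = (\<lambda>z. if z \<in> \<int> then deriv H z / (of_real pi * cos (of_real pi * z)) else H z / s z)"
  have eq: "H z = g z * s z" for z
    using zero s0 by (cases "z \<in> \<int>") (auto simp: g_def elim!: Ints_cases)
  have Hd: "(H has_field_derivative deriv H z) (at z)" for z
    using hol by (simp add: holomorphic_derivI)
  \<comment> \<open>Singularities are removed finitely many at a time, hence locally: a ball of
    radius 1/2 meets only finitely many integers.\<close>
  have "g holomorphic_on ball z (1/2)" for z
  proof (rule no_isolated_singularity'[where K = "\<int> \<inter> ball z (1/2)"])
    show "finite (\<int> \<inter> ball z (1/2))"
    proof (rule finite_subset)
      show "\<int> \<inter> ball z (1/2) \<subseteq> of_int ` {\<lfloor>Re z\<rfloor> - 1..\<lfloor>Re z\<rfloor> + 1}"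
      proof
        fix w assume w: "w \<in> \<int> \<inter> ball z (1/2)"
        then obtain n :: int where n: "w = of_int n"
          by (auto elim: Ints_cases)
        have "\<bar>Re z - of_int n\<bar> < 1/2"
          using w abs_Re_le_cmod[of "z - w"] by (simp add: n dist_norm)
        then have "real_of_int n < real_of_int (\<lfloor>Re z\<rfloor> + 2)" "real_of_int (\<lfloor>Re z\<rfloor> - 2) < real_of_int n"
          using floor_correct[of "Re z"] unfolding of_int_add of_int_diff of_int_numeral of_int_1 by linarith+
        then have "n \<in> {\<lfloor>Re z\<rfloor> - 1..\<lfloor>Re z\<rfloor> + 1}"
          unfolding of_int_less_iff by simp
        then show "w \<in> of_int ` {\<lfloor>Re z\<rfloor> - 1..\<lfloor>Re z\<rfloor> + 1}"
          using n by blast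
      qed
    qed auto
    have "(\<lambda>z. H z / s z) holomorphic_on ball z (1/2) - \<int>"
      unfolding s_def using s0 by (intro holomorphic_intros holomorphic_on_subset[OF hol]) (auto simp: s_def)
    then show "g holomorphic_on ball z (1/2) - \<int> \<inter> ball z (1/2)"
      by (rule holomorphic_transform[THEN holomorphic_on_subset]) (auto simp: g_def)
  next
    fix w assume "w \<in> \<int> \<inter> ball z (1/2)"
    then have w: "w \<in> \<int>"
      by simp
    have "((\<lambda>v. H v / s v) \<longlongrightarrow> g w) (at w)"
      using w zero s0 sd0[OF w] by (intro lhopital_complex_simple[OF Hd sd]) (auto simp: g_def elim!: Ints_cases)
    moreover have "\<forall>\<^sub>F v in at w. H v / s v = g v"
    proof -
      have "\<forall>\<^sub>F v in at w. v \<notin> \<int>"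
      proof -
        have "v \<notin> \<int>" if "v \<noteq> w" "dist v w < 1" for v
        proof
          assume "v \<in> \<int>"
          with w have "v - w \<in> \<int>"
            by simp
          then obtain k :: int where k: "v - w = of_int k"
            by (auto elim: Ints_cases)
          then have "\<bar>k\<bar> < 1"
            using that by (simp add: dist_norm flip: of_int_abs)
          then show False
            using k that by simp
        qed
        then show ?thesis
          by (auto simp: eventually_at intro!: exI[of _ 1])
      qed
      then show ?thesis
        by eventually_elim (simp add: g_def)
    qed
    ultimately have "(g \<longlongrightarrow> g w) (at w)"
      by (rule Lim_transform_eventually)
    then show "(g \<longlongrightarrow> g w) (at w within ball z (1/2))"
      by (rule tendsto_within_subset) auto
  qed auto
  then have "g holomorphic_on (\<Union>z. ball z (1/2))"
    by (intro holomorphic_on_UN_open) auto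
  moreover have "z \<in> ball z (1/2)" for z :: complex
    by simp
  then have "(\<Union>z::complex. ball z (1/2)) = UNIV"
    by blast
  ultimately show ?thesis
    using that eq by (simp add: s_def)
qed

text \<open>With E = exp(2 pi |Im z|), |sin(pi z)|^2 = (E + 1/E - 2 cos(2 pi Re z)) / 4. This is
  comparable to E away from the real axis and on the vertical lines through the half-integers, which
  together contain the boundaries of cells around the integers.\<close>

lemma exp_le_norm_sin_pi:
  assumes "\<bar>Im z\<bar> \<ge> 1 / 4 \<or> cos (2 * (pi * Re z)) = -1"
  shows "exp (pi * \<bar>Im z\<bar>) \<le> 5 * norm (sin (of_real pi * z))"
proof -
  define E where "E = exp (2 * pi * \<bar>Im z\<bar>)"
  have E: "E \<ge> 1"
    by (simp add: E_def)
  have EE: "exp (2 * (pi * Im z)) + inverse (exp (2 * (pi * Im z))) = E + inverse E"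
    by (cases "Im z \<ge> 0") (simp_all add: E_def exp_minus[symmetric] mult.assoc)
  have "E \<ge> 5 / 2" if "\<bar>Im z\<bar> \<ge> 1 / 4"
  proof -
    have "1 + pi / 2 \<le> exp (pi / 2)"
      by (rule exp_ge_add_one_self)
    also have "\<dots> \<le> E"
      unfolding E_def using that by simp
    finally show ?thesis
      using pi_gt3 by simp
  qed
  moreover have "0 \<le> inverse E"
    using E by simp
  moreover have "cos (2 * (pi * Re z)) \<le> 1"
    by simp
  \<comment> \<open>If |Im z| \<ge> 1/4, then E \<ge> 5/2 and E - 2 \<ge> E / 5 \<ge> 4 E / 25. If
    the cosine is -1, the right-hand side is at least E / 4. The 25 is the square of the 5 in the
    claim.\<close>
  ultimately have "E / 25 \<le> (E + inverse E - 2 * cos (2 * (pi * Re z))) / 4"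
    using assms E by argo
  also have "\<dots> = (norm (sin (of_real pi * z)))\<^sup>2"
    unfolding norm_sin_squared by (simp add: EE)
  finally have "E \<le> (5 * norm (sin (of_real pi * z)))\<^sup>2"
    by (simp add: power_mult_distrib)
  moreover have "E = (exp (pi * \<bar>Im z\<bar>))\<^sup>2"
    by (simp add: E_def exp_double[symmetric] mult.assoc)
  ultimately show ?thesis
    by (auto intro: power2_le_imp_le[where y = "5 * norm (sin (of_real pi * z))"])
qed

text \<open>On the imaginary axis the bound is C, but a half-plane is too wide for
  \<open>phragmen_lindelof_sector\<close>. On the rays at angle d to that axis the exponent is pi r
  (1 - cos d), of second order in d, whereas the factor exp(- a z) gains a r sin d, of first order.
  So a multiplier a that vanishes with d makes g bounded on these rays.\<close>

lemma carlson_bound: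
  fixes g :: "complex \<Rightarrow> complex"
  assumes hol: "g holomorphic_on UNIV"
    and bound: "\<And>z. norm (g z) \<le> C * exp (pi * (norm z - \<bar>Im z\<bar>))"
  shows "norm (g z) \<le> C"
proof -
  have right: "norm (g z) \<le> C" if hol: "g holomorphic_on UNIV"
    and bound: "\<And>z. norm (g z) \<le> C * exp (pi * (norm z - \<bar>Im z\<bar>))" and "Re z > 0" for g z
  proof -
    have C: "0 \<le> C"
      using order_trans[OF norm_ge_zero bound[of 0]] by simp
    define t r where "t = Arg z" and "r = norm z"
    have "\<bar>t\<bar> < pi / 2"
      using \<open>Re z > 0\<close> Arg_Re_pos[of z] by (auto simp: t_def)
    have "r > 0"
      using \<open>Re z > 0\<close> by (auto simp: r_def)
    have z: "z = of_real r * cis t"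
      using rcis_cmod_Arg[of z] by (simp add: r_def t_def rcis_def)
    \<comment> \<open>chosen such that \<open>exp (- a d * z)\<close> cancels the growth of \<open>g\<close> on the rays at angle \<open>d\<close> to the imaginary axis\<close>
    define a where "a = (\<lambda>d. pi * ((1 - cos d) / sin d))"
    have main: "norm (g z) * exp (- (a d * Re z)) \<le> C" if d: "0 < d" "d < pi / 2 - \<bar>t\<bar>" for d
    proof -
      define \<theta> where "\<theta> = pi / 2 - d"
      have sd: "sin d > 0"
        using d by (intro sin_gt_zero) auto
      define f where "f = (\<lambda>z. g z * exp (- of_real (a d) * z))"
      have fn: "norm (f w) = norm (g w) * exp (- (a d * Re w))" for w
        by (simp add: f_def norm_mult)
      have ad: "a d \<ge> 0"
        using sd by (simp add: a_def)
      have ray: "norm (f (of_real r * cis s)) \<le> C" if "r > 0" "\<bar>s\<bar> = \<theta>" for r s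
      proof -
        have cs: "cos s = sin d" "\<bar>sin s\<bar> = cos d"
        proof -
          have "cos s = cos \<bar>s\<bar>"
            by (simp add: abs_if)
          then show "cos s = sin d"
            using that by (simp add: \<theta>_def cos_diff)
          have "\<bar>sin s\<bar> = \<bar>sin \<bar>s\<bar>\<bar>"
            by (simp add: abs_if)
          also have "\<dots> = \<bar>cos d\<bar>"
            using that by (simp add: \<theta>_def sin_diff)
          also have "\<dots> = cos d"
            using d cos_ge_zero[of d] by simp
          finally show "\<bar>sin s\<bar> = cos d" .
        qed
        have n: "norm (of_real r * cis s) = r" "\<bar>Im (of_real r * cis s)\<bar> = r * cos d"
          "Re (of_real r * cis s) = r * sin d"
          using that cs by (simp_all add: norm_mult abs_mult)
        have "norm (f (of_real r * cis s)) \<le> C * exp (pi * (r - r * cos d)) * exp (- (a d * (r * sin d)))"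
          unfolding fn using bound[of "of_real r * cis s"] unfolding n by (intro mult_right_mono) auto
        also have "\<dots> = C"
          using sd by (simp add: a_def exp_minus field_simps)
        finally show ?thesis .
      qed
      have "norm (f (of_real r * cis t)) \<le> C"
      proof (rule phragmen_lindelof_sector[where \<theta> = \<theta>])
        show "f holomorphic_on UNIV"
          unfolding f_def using hol by (intro holomorphic_intros)
        show "0 < \<theta>" "\<theta> < pi / 2" "\<bar>t\<bar> \<le> \<theta>" "r > 0"
          using d \<open>r > 0\<close> by (auto simp: \<theta>_def)
        show "norm (f w) \<le> C * exp ((pi + a d) * norm w)" for w
        proof -
          have "norm (f w) \<le> C * exp (pi * (norm w - \<bar>Im w\<bar>)) * exp (- (a d * Re w))"
            unfolding fn by (intro mult_right_mono bound) auto
          also have "\<dots> = C * exp (pi * (norm w - \<bar>Im w\<bar>) - a d * Re w)"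
            unfolding mult.assoc exp_add[symmetric] by simp
          also have "\<dots> \<le> C * exp ((pi + a d) * norm w)"
          proof -
            have "- (a d * Re w) \<le> a d * norm w"
              using mult_left_mono[OF abs_Re_le_cmod[of w] ad] mult_left_mono[OF abs_ge_minus_self[of "Re w"] ad]
              by simp
            moreover have "pi * (norm w - \<bar>Im w\<bar>) \<le> pi * norm w"
              by (intro mult_left_mono) auto
            ultimately have "pi * (norm w - \<bar>Im w\<bar>) - a d * Re w \<le> (pi + a d) * norm w"
              unfolding distrib_right by linarith
            then show ?thesis
              using C by (intro mult_left_mono) auto
          qed
          finally show ?thesis .
        qed
      next
        fix r :: real assume "r > 0"
        then show "norm (f (of_real r * cis \<theta>)) \<le> C" "norm (f (of_real r * cis (- \<theta>))) \<le> C"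
          using d by (intro ray; simp add: \<theta>_def)+
      qed
      then show ?thesis
        unfolding fn[symmetric] z[symmetric] .
    qed
    have "(a \<longlongrightarrow> 0) (at_right 0)"
    proof -
      have "((\<lambda>d::real. (1 - cos d) / sin d) \<longlongrightarrow> 0) (at_right 0)"
        by real_asymp
      then show ?thesis
        unfolding a_def by (rule tendsto_mult_right_zero)
    qed
    then have "((\<lambda>d. norm (g z) * exp (- (a d * Re z))) \<longlongrightarrow> norm (g z)) (at_right 0)"
      by (auto intro!: tendsto_eq_intros)
    moreover have "\<forall>\<^sub>F d in at_right 0. norm (g z) * exp (- (a d * Re z)) \<le> C"
      using main \<open>\<bar>t\<bar> < pi / 2\<close> unfolding eventually_at_right_field
      by (intro exI[of _ "pi / 2 - \<bar>t\<bar>"]) auto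
    ultimately show ?thesis
      by (rule tendsto_upperbound) auto
  qed
  consider "Re z > 0" | "Re z < 0" | "Re z = 0"
    by linarith
  then show ?thesis
  proof cases
    case 1
    with right hol bound show ?thesis by blast
  next
    case 2
    have "(\<lambda>z. g (- z)) holomorphic_on UNIV"
    proof -
      have "(g \<circ> uminus) holomorphic_on UNIV"
        by (intro holomorphic_on_compose holomorphic_intros holomorphic_on_subset[OF hol]) auto
      then show ?thesis
        by (simp add: o_def)
    qed
    moreover have "norm (g (- z)) \<le> C * exp (pi * (norm z - \<bar>Im z\<bar>))" for z
      using bound[of "- z"] by simp
    ultimately have "norm (g (- (- z))) \<le> C"
      using right[of "\<lambda>z. g (- z)" "- z"] 2 by simp
    then show ?thesis by simp
  next
    case 3
    then have "norm z = \<bar>Im z\<bar>"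
      by (simp add: cmod_def)
    then show ?thesis
      using bound[of z] by simp
  qed
qed

text \<open>The quotient of H by sin(pi z) is entire and bounded, hence constant, and the factor
  \<epsilon> forces the constant to be 0.\<close>

theorem carlson:
  fixes H :: "complex \<Rightarrow> complex"
  assumes hol: "H holomorphic_on UNIV" and zero: "\<And>n::int. H (of_int n) = 0"
    and \<epsilon>: "(\<epsilon> \<longlongrightarrow> 0) at_top" and bound: "\<And>z. norm (H z) \<le> \<epsilon> (norm z) * exp (pi * norm z)"
  shows "H z = 0"
proof -
  obtain g where ghol: "g holomorphic_on UNIV" and gH: "\<And>z. H z = g z * sin (of_real pi * z)"
    using divide_by_sin_pi[OF hol zero] by blast
  \<comment> \<open>\<epsilon> is controlled only for large arguments; on the remaining disc H is
    bounded by compactness.\<close>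
  obtain K where K: "\<And>z. norm (H z) \<le> K * exp (pi * norm z)"
  proof -
    have "\<forall>\<^sub>F r in at_top. \<epsilon> r < 1"
      using \<epsilon> by (rule order_tendstoD) simp
    then obtain R where R: "\<And>r. r \<ge> R \<Longrightarrow> \<epsilon> r < 1"
      by (auto simp: eventually_at_top_linorder)
    have "bounded (H ` cball 0 R)"
      using hol by (intro compact_imp_bounded compact_continuous_image
          holomorphic_on_imp_continuous_on holomorphic_on_subset[OF hol]) auto
    then obtain B where "\<forall>z\<in>cball 0 R. norm (H z) \<le> B"
      by (auto simp: bounded_iff)
    then have B: "norm (H z) \<le> B" if "norm z \<le> R" for z
      using that by simp
    have "norm (H z) \<le> max 1 B * exp (pi * norm z)" for z
    proof (cases "norm z \<le> R")
      case True
      have "norm (H z) \<le> max 1 B * 1"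
        using B[OF True] by simp
      also have "\<dots> \<le> max 1 B * exp (pi * norm z)"
        by (intro mult_left_mono) auto
      finally show ?thesis .
    next
      case False
      have "norm (H z) \<le> \<epsilon> (norm z) * exp (pi * norm z)"
        by (rule bound)
      also have "\<dots> \<le> max 1 B * exp (pi * norm z)"
        using R[of "norm z"] False by (intro mult_right_mono) auto
      finally show ?thesis .
    qed
    then show ?thesis
      using that by blast
  qed
  have K0: "K \<ge> 0"
    using order_trans[OF norm_ge_zero K[of 0]] by simp
  have g1: "norm (g z) * exp (pi * \<bar>Im z\<bar>) \<le> 5 * norm (H z)"
    if "\<bar>Im z\<bar> \<ge> 1 / 4 \<or> cos (2 * (pi * Re z)) = -1" for z
    using mult_left_mono[OF exp_le_norm_sin_pi[OF that] norm_ge_zero[of "g z"]]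
    by (simp add: gH norm_mult)
  have g2: "norm (g z) \<le> 5 * K * exp (pi * (norm z - \<bar>Im z\<bar>))"
    if "\<bar>Im z\<bar> \<ge> 1 / 4 \<or> cos (2 * (pi * Re z)) = -1" for z
    using g1[OF that] K[of z] by (simp add: right_diff_distrib exp_diff field_simps)
  \<comment> \<open>In the cell of z one has |w| \<le> |z| + 2, and |Im z| < 1/4 there; so the
    exponent pi (|z| + 2) is at most 3 pi + pi (|z| - |Im z|).\<close>
  define C where "C = 5 * K * exp (3 * pi)"
  have g3: "norm (g z) \<le> C * exp (pi * (norm z - \<bar>Im z\<bar>))" for z
  proof (cases "\<bar>Im z\<bar> \<ge> 1 / 4")
    case True
    have "norm (g z) \<le> 5 * K * exp (pi * (norm z - \<bar>Im z\<bar>))"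
      using g2 True by blast
    also have "\<dots> \<le> C * exp (pi * (norm z - \<bar>Im z\<bar>))"
    proof -
      have "5 * K * 1 \<le> C"
        unfolding C_def using K0 by (intro mult_left_mono) auto
      then show ?thesis
        by (intro mult_right_mono) auto
    qed
    finally show ?thesis .
  next
    case False
    define n where "n = \<lfloor>Re z + 1 / 2\<rfloor>"
    have n: "real_of_int n - 1 / 2 \<le> Re z" "Re z < real_of_int n + 1 / 2"
      unfolding n_def by linarith+
    \<comment> \<open>The cell around the nearest integer. On its boundary the sine is bounded
      below; the maximum principle carries the bound for g into the interior, where the sine has a
      zero.\<close>
    define S where "S = cbox (Complex (n - 1 / 2) (- 1 / 4)) (Complex (n + 1 / 2) (1 / 4))"
    have "norm (g z) \<le> 5 * K * exp (pi * (norm z + 2))"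
    proof (rule maximum_modulus_frontier[of g S])
      show "g holomorphic_on interior S"
        using ghol by (rule holomorphic_on_subset) auto
      show "continuous_on (closure S) g"
        by (intro holomorphic_on_imp_continuous_on holomorphic_on_subset[OF ghol]) auto
      show "bounded S"
        by (simp add: S_def bounded_cbox)
      show "z \<in> S"
        using n False by (auto simp: S_def in_cbox_complex_iff)
      fix w assume "w \<in> frontier S"
      then have w: "w \<in> S" "w \<notin> interior S"
        by (auto simp: frontier_def S_def)
      then have wb: "n - 1 / 2 \<le> Re w" "Re w \<le> n + 1 / 2" "\<bar>Im w\<bar> \<le> 1 / 4"
        by (auto simp: S_def in_cbox_complex_iff)
      from w(2) have "\<not> (n - 1 / 2 < Re w \<and> Re w < n + 1 / 2 \<and> - 1 / 4 < Im w \<and> Im w < 1 / 4)"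
        by (simp add: S_def interior_cbox in_box_complex_iff)
      with wb have *: "Re w = n + 1 / 2 \<or> Re w = n - 1 / 2 \<or> \<bar>Im w\<bar> \<ge> 1 / 4"
        by linarith
      have "cos (2 * (pi * Re w)) = -1" if "Re w = n + 1 / 2"
      proof -
        have "2 * (pi * Re w) = 2 * pi * n + pi"
          unfolding that by (simp add: algebra_simps)
        then show ?thesis
          by (simp only: cos_add cos_int_2pin sin_int_2pin cos_pi sin_pi)
      qed
      moreover have "cos (2 * (pi * Re w)) = -1" if "Re w = n - 1 / 2"
      proof -
        have "2 * (pi * Re w) = 2 * pi * n - pi"
          unfolding that by (simp add: algebra_simps)
        then show ?thesis
          by (simp only: cos_diff cos_int_2pin sin_int_2pin cos_pi sin_pi)
      qed
      ultimately have "\<bar>Im w\<bar> \<ge> 1 / 4 \<or> cos (2 * (pi * Re w)) = -1"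
        using * by blast
      then have "norm (g w) \<le> 5 * K * exp (pi * (norm w - \<bar>Im w\<bar>))"
        by (rule g2)
      also have "\<dots> \<le> 5 * K * exp (pi * (norm z + 2))"
      proof -
        have "norm (w - z) \<le> \<bar>Re (w - z)\<bar> + \<bar>Im (w - z)\<bar>"
          by (rule cmod_le)
        also have "\<dots> \<le> 2"
          using wb n False by simp
        finally have "norm w \<le> norm z + 2"
          using norm_triangle_ineq2[of w z] by linarith
        then show ?thesis
          using K0 by (intro mult_left_mono) auto
      qed
      finally show "norm (g w) \<le> 5 * K * exp (pi * (norm z + 2))" .
    qed
    also have "\<dots> \<le> 5 * K * exp (3 * pi + pi * (norm z - \<bar>Im z\<bar>))"
    proof -
      have "pi * (norm z + 2) \<le> pi * (3 + (norm z - \<bar>Im z\<bar>))"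
        using False by (intro mult_left_mono) auto
      then show ?thesis
        using K0 by (intro mult_left_mono) (auto simp: algebra_simps)
    qed
    also have "\<dots> = C * exp (pi * (norm z - \<bar>Im z\<bar>))"
      by (simp add: C_def exp_add)
    finally show ?thesis .
  qed
  have "bounded (range g)"
    using carlson_bound[OF ghol g3] by (auto simp: bounded_iff)
  then obtain c where c: "\<And>z. g z = c"
    using Liouville_theorem[OF ghol] by (auto simp: constant_on_def)
  \<comment> \<open>On the imaginary axis |z| = |Im z|, so the exponentials cancel and only
    \<open>5 * \<epsilon> r\<close> remains.\<close>
  have "norm c \<le> 0"
  proof (rule tendsto_lowerbound)
    show "((\<lambda>r. 5 * \<epsilon> r) \<longlongrightarrow> 0) at_top"
      using tendsto_mult_right_zero[OF \<epsilon>] by simp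
    show "\<forall>\<^sub>F r in at_top. norm c \<le> 5 * \<epsilon> r"
      using eventually_ge_at_top[of 1]
    proof eventually_elim
      case (elim r)
      define z where "z = Complex 0 r"
      have z: "norm z = r" "\<bar>Im z\<bar> = r"
        using elim by (auto simp: z_def cmod_def)
      have "norm c * exp (pi * r) \<le> 5 * (\<epsilon> r * exp (pi * r))"
        using g1[of z] bound[of z] elim unfolding z c by linarith
      then show ?case
        unfolding mult.assoc[symmetric] by simp
    qed
  qed auto
  then show ?thesis
    by (simp add: gH c)
qed

section \<open>Square-integrable functions\<close>

lemma L2_measurable [measurable_dest]: "f \<in> L2 M \<Longrightarrow> f \<in> borel_measurable M"
  by (simp add: L2_def)

lemma L2_integrable_square: "f \<in> L2 M \<Longrightarrow> integrable M (\<lambda>x. (norm (f x))\<^sup>2)"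
  by (simp add: L2_def)

lemma L2_integrable_norm_mult:
  assumes "f \<in> L2 M" "g \<in> L2 M"
  shows "integrable M (\<lambda>x. norm (f x) * norm (g x))"
proof (rule Bochner_Integration.integrable_bound)
  show "integrable M (\<lambda>x. (norm (f x))\<^sup>2 + (norm (g x))\<^sup>2)"
    using assms by (intro Bochner_Integration.integrable_add L2_integrable_square)
  show "(\<lambda>x. norm (f x) * norm (g x)) \<in> borel_measurable M"
    using assms by measurable
  have "norm (f x) * norm (g x) \<le> (norm (f x))\<^sup>2 + (norm (g x))\<^sup>2" for x
    using sum_squares_bound[of "norm (f x)" "norm (g x)"]
      mult_nonneg_nonneg[OF norm_ge_zero[of "f x"] norm_ge_zero[of "g x"]] unfolding mult.assoc
    by linarith
  then show "AE x in M. norm (norm (f x) * norm (g x)) \<le> norm ((norm (f x))\<^sup>2 + (norm (g x))\<^sup>2)"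
    by simp
qed

lemma L2_integrable_mult:
  assumes "f \<in> L2 M" "g \<in> L2 M"
  shows "integrable M (\<lambda>x. f x * g x)"
proof (rule Bochner_Integration.integrable_bound[OF L2_integrable_norm_mult[OF assms]])
  show "(\<lambda>x. f x * g x) \<in> borel_measurable M"
    using assms by measurable
qed (simp add: norm_mult)

lemma L2_cnj: "f \<in> L2 M \<Longrightarrow> (\<lambda>x. cnj (f x)) \<in> L2 M"
  using measurable_compose[of f M borel cnj borel]
    borel_measurable_continuous_onI[OF continuous_on_cnj[OF continuous_on_id]]
  by (simp add: L2_def)

lemma L2_cmult: "f \<in> L2 M \<Longrightarrow> (\<lambda>x. c * f x) \<in> L2 M"
  by (auto simp: L2_def norm_mult power_mult_distrib)

lemma L2_add:
  assumes "f \<in> L2 M" "g \<in> L2 M"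
  shows "(\<lambda>x. f x + g x) \<in> L2 M"
proof -
  have "integrable M (\<lambda>x. (norm (f x + g x))\<^sup>2)"
  proof (rule Bochner_Integration.integrable_bound)
    show "integrable M (\<lambda>x. 2 * (norm (f x))\<^sup>2 + 2 * (norm (g x))\<^sup>2)"
      using assms by (intro Bochner_Integration.integrable_add integrable_mult_right L2_integrable_square)
    show "(\<lambda>x. (norm (f x + g x))\<^sup>2) \<in> borel_measurable M"
      using assms by measurable
    have "(norm (f x + g x))\<^sup>2 \<le> 2 * (norm (f x))\<^sup>2 + 2 * (norm (g x))\<^sup>2" for x
    proof -
      have "(norm (f x + g x))\<^sup>2 \<le> (norm (f x) + norm (g x))\<^sup>2"
        by (intro power_mono norm_triangle_ineq) auto
      also have "\<dots> \<le> 2 * (norm (f x))\<^sup>2 + 2 * (norm (g x))\<^sup>2"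
        using sum_squares_bound[of "norm (f x)" "norm (g x)"] by (simp add: power2_sum)
      finally show ?thesis .
    qed
    then show "AE x in M. norm ((norm (f x + g x))\<^sup>2) \<le> norm (2 * (norm (f x))\<^sup>2 + 2 * (norm (g x))\<^sup>2)"
      by simp
  qed
  then show ?thesis
    using assms by (auto simp: L2_def)
qed

lemma L2_diff:
  assumes "f \<in> L2 M" "g \<in> L2 M"
  shows "(\<lambda>x. f x - g x) \<in> L2 M"
  using L2_add[OF assms(1) L2_cmult[OF assms(2), of "-1"]] by simp

lemma L2_zero: "(\<lambda>x. 0) \<in> L2 M"
  by (simp add: L2_def)

lemma L2_sum: "(\<And>i. i \<in> A \<Longrightarrow> f i \<in> L2 M) \<Longrightarrow> (\<lambda>x. \<Sum>i\<in>A. f i x) \<in> L2 M"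
  by (induction A rule: infinite_finite_induct) (simp_all add: L2_zero L2_add)

lemma L2_Cauchy_Schwarz:
  assumes f: "f \<in> L2 M" and g: "g \<in> L2 M"
  shows "(norm (\<integral>x. f x * g x \<partial>M))\<^sup>2 \<le> (\<integral>x. (norm (f x))\<^sup>2 \<partial>M) * (\<integral>x. (norm (g x))\<^sup>2 \<partial>M)"
proof -
  have [measurable]: "f \<in> borel_measurable M" "g \<in> borel_measurable M"
    using f g by (simp_all add: L2_def)
  let ?I = "\<integral>x. norm (f x) * norm (g x) \<partial>M"
  have "norm (\<integral>x. f x * g x \<partial>M) \<le> (\<integral>x. norm (f x * g x) \<partial>M)"
    by (rule integral_norm_bound)
  then have "(norm (\<integral>x. f x * g x \<partial>M))\<^sup>2 \<le> ?I\<^sup>2"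
    by (intro power_mono) (auto simp: norm_mult)
  also have "?I\<^sup>2 \<le> (\<integral>x. (norm (f x))\<^sup>2 \<partial>M) * (\<integral>x. (norm (g x))\<^sup>2 \<partial>M)"
  proof -
    have 1: "(\<integral>\<^sup>+x. ennreal (norm (f x)) * ennreal (norm (g x)) \<partial>M) = ennreal ?I"
      using L2_integrable_norm_mult[OF f g]
      by (simp add: ennreal_mult[symmetric] nn_integral_eq_integral)
    have 2: "(\<integral>\<^sup>+x. (ennreal (norm (h x)))\<^sup>2 \<partial>M) = ennreal (\<integral>x. (norm (h x))\<^sup>2 \<partial>M)" if "h \<in> L2 M" for h
      using L2_integrable_square[OF that] by (simp add: ennreal_power nn_integral_eq_integral)
    have "(\<integral>\<^sup>+x. ennreal (norm (f x)) * ennreal (norm (g x)) \<partial>M)\<^sup>2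
        \<le> (\<integral>\<^sup>+x. (ennreal (norm (f x)))\<^sup>2 \<partial>M) * (\<integral>\<^sup>+x. (ennreal (norm (g x)))\<^sup>2 \<partial>M)"
      by (rule Cauchy_Schwarz_nn_integral) auto
    then show ?thesis
      unfolding 1 2[OF f] 2[OF g]
      by (simp add: ennreal_power ennreal_mult[symmetric] integral_nonneg_AE)
  qed
  finally show ?thesis .
qed

lemma L2_bounded:
  assumes "finite_measure M" and "f \<in> borel_measurable M" "\<And>x. x \<in> space M \<Longrightarrow> norm (f x) \<le> B"
  shows "f \<in> L2 M"
proof -
  interpret finite_measure M by fact
  have "integrable M (\<lambda>x. (norm (f x))\<^sup>2)"
  proof (rule integrable_const_bound[where B = "B\<^sup>2"])
    show "AE x in M. norm ((norm (f x))\<^sup>2) \<le> B\<^sup>2"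
      using assms by (intro AE_I2) (auto intro: power_mono)
  qed (use assms in measurable)
  then show ?thesis
    using assms by (simp add: L2_def)
qed

lemma L2_integrable:
  assumes "finite_measure M" and "f \<in> L2 M"
  shows "integrable M f"
  using L2_integrable_mult[OF assms(2) L2_bounded[OF assms(1), of "\<lambda>x. 1" 1]] by simp

text \<open>Riesz-Fischer for functions instead of classes: a subsequence with geometrically small
  steps converges almost everywhere, and Fatou's lemma turns its pointwise limit into the limit in
  norm of the whole sequence.\<close>

lemma L2_complete:
  fixes s :: "nat \<Rightarrow> real \<Rightarrow> complex"
  assumes M: "finite_measure M" and s: "\<And>n. s n \<in> L2 M"
    and Cauchy: "\<And>e. e > 0 \<Longrightarrow> \<exists>N. \<forall>m\<ge>N. \<forall>n\<ge>N. (\<integral>x. (norm (s m x - s n x))\<^sup>2 \<partial>M) \<le> e"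
  obtains f where "f \<in> L2 M" "(\<lambda>n. \<integral>x. (norm (f x - s n x))\<^sup>2 \<partial>M) \<longlonglongrightarrow> 0"
proof -
  interpret finite_measure M by fact
  have [measurable]: "s n \<in> borel_measurable M" for n
    using s by (simp add: L2_def)
  have "\<exists>N. \<forall>k. \<forall>m\<ge>N k. \<forall>n\<ge>N k. (\<integral>x. (norm (s m x - s n x))\<^sup>2 \<partial>M) \<le> (1 / 4) ^ k"
    by (intro choice allI Cauchy) simp
  then obtain N where N: "\<And>k m n. m \<ge> N k \<Longrightarrow> n \<ge> N k \<Longrightarrow> (\<integral>x. (norm (s m x - s n x))\<^sup>2 \<partial>M) \<le> (1 / 4) ^ k"
    by blast
  \<comment> \<open>Summing the N i puts both \<open>r k\<close> and \<open>r (Suc k)\<close> beyond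
    N k; the summand k makes r unbounded.\<close>
  define r where "r k = k + (\<Sum>i\<le>k. N i)" for k :: nat
  have rN: "N k \<le> r k" "N k \<le> r (Suc k)" "k \<le> r k" for k
    using member_le_sum[of k "{..k}" N] by (auto simp: r_def)
  define d where "d k x = s (r (Suc k)) x - s (r k) x" for k x
  have d: "d k \<in> L2 M" for k
    unfolding d_def by (intro L2_diff s)
  have [measurable]: "d k \<in> borel_measurable M" for k
    using d by (simp add: L2_def)
  define C where "C = (1 + measure M (space M)) / 2"
  have d1: "(\<integral>x. norm (d k x) \<partial>M) \<le> C * (1 / 2) ^ k" for k
  proof -
    have "(\<integral>x. norm (d k x) \<partial>M) \<le> (\<integral>x. (2 ^ k * (norm (d k x))\<^sup>2 + (1 / 2) ^ k) / 2 \<partial>M)"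
    proof (rule integral_mono)
      show "integrable M (\<lambda>x. norm (d k x))"
        using L2_integrable[OF M d] by simp
      show "integrable M (\<lambda>x. (2 ^ k * (norm (d k x))\<^sup>2 + (1 / 2) ^ k) / 2)"
        using L2_integrable_square[OF d] by simp
      fix x
      \<comment> \<open>Arithmetic-geometric mean with weight 2^k. As the square of d k has integral
        at most 1 / 4^k, both terms contribute the order 1 / 2^k.\<close>
      have "0 \<le> (2 ^ k * norm (d k x) - 1)\<^sup>2 / 2 ^ k"
        by simp
      then show "norm (d k x) \<le> (2 ^ k * (norm (d k x))\<^sup>2 + (1 / 2) ^ k) / 2"
        by (simp add: power2_eq_square power_one_over field_simps)
    qed
    also have "\<dots> = (2 ^ k * (\<integral>x. (norm (d k x))\<^sup>2 \<partial>M) + (1 / 2) ^ k * measure M (space M)) / 2"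
      using L2_integrable_square[OF d[of k]] by (simp add: mult.commute)
    also have "\<dots> \<le> (2 ^ k * (1 / 4) ^ k + (1 / 2) ^ k * measure M (space M)) / 2"
      unfolding d_def using N[of k "r (Suc k)" "r k"] rN by (auto intro!: divide_right_mono)
    also have "2 ^ k * (1 / 4) ^ k = (1 / 2 :: real) ^ k"
      by (simp add: power_mult_distrib[symmetric])
    finally show ?thesis
      by (simp add: C_def field_simps)
  qed
  have sumd: "AE x in M. summable (\<lambda>k. norm (d k x))"
  proof -
    have "(\<integral>\<^sup>+x. (\<Sum>k. ennreal (norm (d k x))) \<partial>M) = (\<Sum>k. \<integral>\<^sup>+x. ennreal (norm (d k x)) \<partial>M)"
      by (intro nn_integral_suminf) auto
    also have "\<dots> = (\<Sum>k. ennreal (\<integral>x. norm (d k x) \<partial>M))"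
      using L2_integrable[OF M d] by (simp add: nn_integral_eq_integral)
    also have "\<dots> \<noteq> top"
    proof (rule ennreal_suminf_neq_top)
      show "summable (\<lambda>k. \<integral>x. norm (d k x) \<partial>M)"
      proof (rule summable_comparison_test')
        show "summable (\<lambda>k. C * (1 / 2) ^ k)"
          by (intro summable_mult summable_geometric) simp
        show "norm (\<integral>x. norm (d k x) \<partial>M) \<le> C * (1 / 2) ^ k" if "k \<ge> 0" for k
          using d1[of k] by simp
      qed
    qed (auto simp: integral_nonneg_AE)
    finally have "AE x in M. (\<Sum>k. ennreal (norm (d k x))) \<noteq> \<infinity>"
      by (intro nn_integral_PInf_AE) auto
    then show ?thesis
      by eventually_elim (auto intro: summable_suminf_not_top)
  qed
  define f where "f x = s (r 0) x + (\<Sum>k. d k x)" for x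
  have [measurable]: "f \<in> borel_measurable M"
    unfolding f_def by measurable
  have lim: "AE x in M. (\<lambda>k. s (r k) x) \<longlonglongrightarrow> f x"
    using sumd
  proof eventually_elim
    case (elim x)
    have "(\<lambda>n. \<Sum>k<n. d k x) \<longlonglongrightarrow> (\<Sum>k. d k x)"
      by (rule summable_LIMSEQ[OF summable_norm_cancel[OF elim]])
    moreover have "(\<Sum>k<n. d k x) = s (r n) x - s (r 0) x" for n
      unfolding d_def by (rule sum_lessThan_telescope)
    ultimately have "(\<lambda>n. s (r 0) x + (s (r n) x - s (r 0) x)) \<longlonglongrightarrow> f x"
      unfolding f_def by (intro tendsto_add tendsto_const) simp
    then show ?case
      by simp
  qed
  \<comment> \<open>Fatou in the index of the subsequence, with m fixed; this gives the estimate for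
    every m beyond N k, not only along the subsequence.\<close>
  have bound: "(\<integral>\<^sup>+x. ennreal ((norm (f x - s m x))\<^sup>2) \<partial>M) \<le> ennreal ((1 / 4) ^ k)" if "m \<ge> N k" for m k
  proof -
    have "(\<integral>\<^sup>+x. ennreal ((norm (f x - s m x))\<^sup>2) \<partial>M)
        = (\<integral>\<^sup>+x. liminf (\<lambda>i. ennreal ((norm (s (r i) x - s m x))\<^sup>2)) \<partial>M)"
    proof (rule nn_integral_cong_AE)
      show "AE x in M. ennreal ((norm (f x - s m x))\<^sup>2) = liminf (\<lambda>i. ennreal ((norm (s (r i) x - s m x))\<^sup>2))"
        using lim
      proof eventually_elim
        case (elim x)
        have "(\<lambda>i. ennreal ((norm (s (r i) x - s m x))\<^sup>2)) \<longlonglongrightarrow> ennreal ((norm (f x - s m x))\<^sup>2)"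
          using elim by (intro tendsto_intros)
        then show ?case
          by (rule lim_imp_Liminf[OF sequentially_bot, symmetric])
      qed
    qed
    also have "\<dots> \<le> liminf (\<lambda>i. \<integral>\<^sup>+x. ennreal ((norm (s (r i) x - s m x))\<^sup>2) \<partial>M)"
      by (rule nn_integral_liminf) measurable
    also have "\<dots> \<le> ennreal ((1 / 4) ^ k)"
    proof (rule order_trans[OF Liminf_mono])
      have "\<forall>\<^sub>F i in sequentially. N k \<le> i"
        by (rule eventually_ge_at_top)
      then show "\<forall>\<^sub>F i in sequentially. (\<integral>\<^sup>+x. ennreal ((norm (s (r i) x - s m x))\<^sup>2) \<partial>M) \<le> ennreal ((1 / 4) ^ k)"
      proof eventually_elim
        case (elim i)
        then have "N k \<le> r i"
          using rN(3)[of i] by linarith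
        then show ?case
          using N[of k "r i" m] that L2_integrable_square[OF L2_diff[OF s[of "r i"] s[of m]]]
          by (simp add: nn_integral_eq_integral)
      qed
      show "liminf (\<lambda>i. ennreal ((1 / 4) ^ k)) \<le> ennreal ((1 / 4) ^ k)"
        by (simp add: Liminf_const)
    qed
    finally show ?thesis .
  qed
  have fs: "(\<lambda>x. f x - s m x) \<in> L2 M" if "m \<ge> N k" for m k
  proof -
    have "integrable M (\<lambda>x. (norm (f x - s m x))\<^sup>2)"
      by (rule integrableI_bounded) (use bound[OF that] in \<open>auto intro: le_less_trans\<close>)
    then show ?thesis
      by (simp add: L2_def)
  qed
  have f: "f \<in> L2 M"
    using L2_add[OF fs[of 0 "N 0"] s[of "N 0"]] by simp
  have ft: "(\<integral>x. (norm (f x - s m x))\<^sup>2 \<partial>M) \<le> (1 / 4) ^ k" if "m \<ge> N k" for m k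
    using bound[OF that] L2_integrable_square[OF L2_diff[OF f s[of m]]]
    by (simp add: nn_integral_eq_integral)
  have "(\<lambda>n. \<integral>x. (norm (f x - s n x))\<^sup>2 \<partial>M) \<longlonglongrightarrow> 0"
  proof (rule order_tendstoI)
    fix e :: real assume "e > 0"
    then obtain k where k: "(1 / 4) ^ k < e"
      using real_arch_pow_inv[of e "1 / 4"] by auto
    show "\<forall>\<^sub>F n in sequentially. (\<integral>x. (norm (f x - s n x))\<^sup>2 \<partial>M) < e"
      using eventually_ge_at_top[of "N k"] by eventually_elim (use ft k in \<open>auto intro: le_less_trans\<close>)
  next
    fix e :: real assume "e < 0"
    then show "\<forall>\<^sub>F n in sequentially. e < (\<integral>x. (norm (f x - s n x))\<^sup>2 \<partial>M)"
      by (intro always_eventually allI) (auto intro: less_le_trans)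
  qed
  with f that show ?thesis
    by blast
qed

section \<open>Characters and the Cauchy transform\<close>

text \<open>To be read with \<alpha> the coefficients of 1 - b and c the Fourier coefficients of the
  measure, so that \<open>inv\<close> says that mu_plus times 1 - b is 1. Both sides change by the
  same rank-one term when n and m both increase by 1, the displacement structure of Toeplitz
  matrices, and \<open>inv\<close> evaluates them when n or m is 0.\<close>

lemma toeplitz_gram:
  fixes \<alpha> \<beta> :: "nat \<Rightarrow> complex" and c :: "int \<Rightarrow> complex"
  assumes c0: "c 0 = 1" and cneg: "\<And>i. c (- i) = cnj (c i)"
    and inv: "\<And>m. (\<Sum>k\<le>m. \<alpha> (m - k) * c (int k)) = (if m = 0 then 1 else 0)"
    and \<beta>: "\<And>n. \<beta> n = (if n = 0 then 1 else 0) - \<alpha> n"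
  shows "(\<Sum>j\<le>n. \<Sum>k\<le>m. cnj (\<alpha> (n - j)) * \<alpha> (m - k) * c (int k - int j))
    = (if n = m then 1 else 0) - (\<Sum>j\<le>min n m. cnj (\<beta> (n - j)) * \<beta> (m - j))"
    (is "?G n m = ?R n m")
proof -
  have \<alpha>0: "\<alpha> 0 = 1" and \<beta>0: "\<beta> 0 = 0"
    using inv[of 0] c0 \<beta>[of 0] by simp_all
  have inv': "(\<Sum>j\<le>n. cnj (\<alpha> (n - j)) * c (- int j)) = (if n = 0 then 1 else 0)" for n
  proof -
    have "(\<Sum>j\<le>n. cnj (\<alpha> (n - j)) * c (- int j)) = cnj (\<Sum>k\<le>n. \<alpha> (n - k) * c (int k))"
      by (simp add: cneg)
    then show ?thesis
      by (simp add: inv)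
  qed
  have G0: "?G 0 m = ?R 0 m" for m
    using inv[of m] by (simp add: \<alpha>0 \<beta>0)
  have G0': "?G n 0 = ?R n 0" for n
    using inv'[of n] by (simp add: \<alpha>0 \<beta>0)
  have Gs: "?G (Suc n) (Suc m) = ?G n m - cnj (\<beta> (Suc n)) * \<beta> (Suc m)" for n m
  proof -
    \<comment> \<open>The row j = 0 is a convolution with c and vanishes by \<open>inv\<close>; the
      column k = 0 of the other rows will produce the rank-one term.\<close>
    have 1: "(\<Sum>k\<le>Suc m. cnj (\<alpha> (Suc n)) * \<alpha> (Suc m - k) * c (int k)) = 0"
      using inv[of "Suc m"] by (simp only: mult.assoc sum_distrib_left[symmetric]) simp
    have 2: "(\<Sum>j\<le>n. cnj (\<alpha> (n - j)) * c (- int (Suc j))) = - cnj (\<alpha> (Suc n))"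
      using inv'[of "Suc n"] unfolding sum.atMost_Suc_shift by (simp add: c0 add_eq_0_iff)
    have "?G (Suc n) (Suc m) = (\<Sum>k\<le>Suc m. cnj (\<alpha> (Suc n)) * \<alpha> (Suc m - k) * c (int k))
      + (\<Sum>j\<le>n. \<Sum>k\<le>Suc m. cnj (\<alpha> (n - j)) * \<alpha> (Suc m - k) * c (int k - int (Suc j)))"
      by (subst sum.atMost_Suc_shift) simp
    also have "\<dots> = (\<Sum>j\<le>n. \<Sum>k\<le>Suc m. cnj (\<alpha> (n - j)) * \<alpha> (Suc m - k) * c (int k - int (Suc j)))"
      by (simp only: 1 add_0)
    also have "\<dots> = (\<Sum>j\<le>n. cnj (\<alpha> (n - j)) * c (- int (Suc j)) * \<alpha> (Suc m)
        + (\<Sum>k\<le>m. cnj (\<alpha> (n - j)) * \<alpha> (m - k) * c (int k - int j)))"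
      by (intro sum.cong refl, subst sum.atMost_Suc_shift) (simp add: ac_simps)
    also have "\<dots> = - cnj (\<alpha> (Suc n)) * \<alpha> (Suc m) + ?G n m"
      by (simp only: sum.distrib sum_distrib_right[symmetric] 2)
    finally show ?thesis
      by (simp add: \<beta>)
  qed
  have Rs: "?R (Suc n) (Suc m) = ?R n m - cnj (\<beta> (Suc n)) * \<beta> (Suc m)" for n m
    unfolding min_Suc_Suc by (subst sum.atMost_Suc_shift) simp
  show ?thesis
  proof (induction n arbitrary: m)
    case 0
    show ?case by (rule G0)
  next
    case (Suc n)
    show ?case
    proof (cases m)
      case 0
      then show ?thesis using G0' by simp
    next
      case (Suc m')
      then show ?thesis
        using Gs[of n m'] Rs[of n m'] Suc.IH[of m'] by simp
    qed
  qed
qed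

section \<open>Characters of the circle and Fourier coefficients with respect to a measure\<close>

definition fourier_char :: "int \<Rightarrow> real \<Rightarrow> complex" where
  "fourier_char n x = cis (2 * pi * of_int n * x)"

lemma fourier_char_0 [simp]: "fourier_char 0 x = 1"
  by (simp add: fourier_char_def)

lemma fourier_char_add: "fourier_char (m + n) x = fourier_char m x * fourier_char n x"
  by (simp add: fourier_char_def cis_mult algebra_simps)

lemma cnj_fourier_char [simp]: "cnj (fourier_char n x) = fourier_char (- n) x"
  by (simp add: fourier_char_def cis_cnj)

lemma norm_fourier_char [simp]: "norm (fourier_char n x) = 1"
  by (simp add: fourier_char_def)

lemma fourier_char_measurable_borel [measurable]: "fourier_char n \<in> borel_measurable borel"
  unfolding fourier_char_def cis_conv_exp
  by (intro borel_measurable_continuous_onI continuous_intros)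

lemma cis_power_fourier_char: "cis (- (2 * pi * x)) ^ n = fourier_char (- int n) x"
  by (simp only: fourier_char_def Complex.DeMoivre) (simp add: algebra_simps)

text \<open>Independent of b, so that Lebesgue measure on the interval is an instance as well;
  Parseval's identity relies on that.\<close>

locale circle_probability =
  fixes \<mu> :: "real measure"
  assumes prob_space_\<mu>: "prob_space \<mu>" and sets_eq: "sets \<mu> = sets circle_borel"
begin

sublocale prob_space \<mu>
  by (rule prob_space_\<mu>)

lemma space_eq: "space \<mu> = {-1/2<..<1/2}"
  using sets_eq_imp_space_eq[OF sets_eq] by (simp add: circle_borel_def space_restrict_space)

lemma borel_measurable_circle: "f \<in> borel_measurable borel \<Longrightarrow> f \<in> borel_measurable \<mu>"
  unfolding measurable_cong_sets[OF sets_eq refl] circle_borel_def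
  by (rule measurable_restrict_space1)

lemma fourier_char_measurable [measurable]: "fourier_char n \<in> borel_measurable \<mu>"
  by (intro borel_measurable_circle) simp

lemma fourier_char_L2: "fourier_char n \<in> L2 \<mu>"
  by (rule L2_bounded[where B = 1]) (use finite_measure_axioms in auto)

lemma integrable_mult_fourier_char:
  assumes "f \<in> L2 \<mu>"
  shows "integrable \<mu> (\<lambda>x. f x * fourier_char n x)"
  by (intro L2_integrable_mult assms fourier_char_L2)

definition fourier_coeff :: "(real \<Rightarrow> complex) \<Rightarrow> int \<Rightarrow> complex" where
  "fourier_coeff f n = (\<integral>x. f x * fourier_char (- n) x \<partial>\<mu>)"

lemma one_L2: "(\<lambda>x. 1) \<in> L2 \<mu>"
  by (rule L2_bounded[where B = 1]) (use finite_measure_axioms in auto)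

lemma cauchy_transform_sums:
  assumes f: "f \<in> L2 \<mu>" and z: "norm z < 1"
  shows "(\<lambda>n. fourier_coeff f (int n) * z ^ n) sums (\<integral>x. f x / (1 - z * cis (- (2 * pi * x))) \<partial>\<mu>)"
proof -
  have [measurable]: "f \<in> borel_measurable \<mu>"
    using f by (simp add: L2_def)
  define t where "t n x = f x * (z ^ n * fourier_char (- int n) x)" for n x
  have nt: "norm (t n x) = norm (f x) * norm z ^ n" for n x
    by (simp add: t_def norm_mult norm_power)
  have intt: "integrable \<mu> (t n)" for n
    using integrable_mult_right[OF integrable_mult_fourier_char[OF f], of "z ^ n" "- int n"]
    by (simp add: t_def[abs_def] ac_simps)
  have ts: "(\<lambda>n. t n x) sums (f x / (1 - z * cis (- (2 * pi * x))))" for x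
  proof -
    have "(\<lambda>n. f x * (z * cis (- (2 * pi * x))) ^ n) sums (f x * (1 / (1 - z * cis (- (2 * pi * x)))))"
      using z by (intro sums_mult geometric_sums) (simp add: norm_mult)
    then show ?thesis
      by (simp add: t_def power_mult_distrib cis_power_fourier_char)
  qed
  have "(\<lambda>n. integral\<^sup>L \<mu> (t n)) sums (\<integral>x. (\<Sum>n. t n x) \<partial>\<mu>)"
  proof (rule sums_integral)
    show "AE x in \<mu>. summable (\<lambda>n. norm (t n x))"
      unfolding nt using z by (intro AE_I2 summable_mult summable_geometric) simp
    show "summable (\<lambda>n. \<integral>x. norm (t n x) \<partial>\<mu>)"
      unfolding nt using z by (simp add: summable_mult summable_geometric)
  qed (rule intt)
  moreover have "integral\<^sup>L \<mu> (t n) = fourier_coeff f (int n) * z ^ n" for n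
  proof -
    have "integral\<^sup>L \<mu> (t n) = (\<integral>x. f x * fourier_char (- int n) x * z ^ n \<partial>\<mu>)"
      by (simp add: t_def[abs_def] ac_simps)
    then show ?thesis
      by (simp only: fourier_coeff_def integral_mult_left_zero)
  qed
  ultimately show ?thesis
    using ts by (simp add: sums_iff)
qed

lemma cauchy_transform_holomorphic:
  assumes f: "f \<in> L2 \<mu>"
  shows "(\<lambda>z. \<integral>x. f x / (1 - z * cis (- (2 * pi * x))) \<partial>\<mu>) holomorphic_on ball 0 1"
  using cauchy_transform_sums[OF f] by (intro power_series_holomorphic) auto

lemma cauchy_transform_fps:
  assumes f: "f \<in> L2 \<mu>"
  shows "(\<lambda>z. \<integral>x. f x / (1 - z * cis (- (2 * pi * x))) \<partial>\<mu>)
    has_fps_expansion Abs_fps (\<lambda>n. fourier_coeff f (int n))"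
proof (rule has_fps_expansionI)
  show "\<forall>\<^sub>F z in nhds 0. (\<lambda>n. fps_nth (Abs_fps (\<lambda>n. fourier_coeff f (int n))) n * z ^ n)
      sums (\<integral>x. f x / (1 - z * cis (- (2 * pi * x))) \<partial>\<mu>)"
    using cauchy_transform_sums[OF f] by (auto simp: eventually_nhds_metric intro!: exI[of _ 1])
qed

lemma fourier_coeff_1_minus: "fourier_coeff (\<lambda>x. 1) (- n) = cnj (fourier_coeff (\<lambda>x. 1) n)"
  using Bochner_Integration.integral_cnj[of \<mu> "fourier_char (- n)"] by (simp add: fourier_coeff_def del: Bochner_Integration.integral_cnj)

lemma fourier_coeff_1_0: "fourier_coeff (\<lambda>x. 1) 0 = 1"
  by (simp add: fourier_coeff_def prob_space)

lemma integrable_cauchy_kernel: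
  assumes z: "norm z < 1"
  shows "integrable \<mu> (\<lambda>x. 1 / (1 - z * cis (- (2 * pi * x))))"
proof (rule integrable_const_bound[where B = "1 / (1 - norm z)"])
  have "norm (1 / (1 - z * cis (- (2 * pi * x)))) \<le> 1 / (1 - norm z)" for x
    using norm_triangle_ineq2[of 1 "z * cis (- (2 * pi * x))"] z
    by (simp add: norm_divide norm_mult frac_le)
  then show "AE x in \<mu>. norm (1 / (1 - z * cis (- (2 * pi * x)))) \<le> 1 / (1 - norm z)"
    by simp
  show "(\<lambda>x. 1 / (1 - z * cis (- (2 * pi * x)))) \<in> borel_measurable \<mu>"
  proof (rule borel_measurable_circle, rule borel_measurable_continuous_onI)
    have "1 - z * cis (- (2 * pi * x)) \<noteq> 0" for x
      using z norm_mult[of z "cis (- (2 * pi * x))"]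
      by (metis eq_iff_diff_eq_0 norm_one less_irrefl norm_cis mult.right_neutral)
    then show "continuous_on UNIV (\<lambda>x. 1 / (1 - z * cis (- (2 * pi * x))))"
      by (intro continuous_intros) auto
  qed
qed

text \<open>Re (1 / (1 - w)) exceeds 1/2 by half the Poisson kernel (1 - |w|^2) / |1 - w|^2.
  Strictness survives integration because |w| = |z| is fixed.\<close>

lemma Re_mu_plus:
  assumes z: "norm z < 1"
  shows "Re (mu_plus \<mu> z) > 1 / 2"
proof -
  \<comment> \<open>As |1 - w|^2 \<le> 4, half the Poisson kernel is at least (1 - |z|^2) /
    8.\<close>
  define \<delta> where "\<delta> = (1 - (norm z)\<^sup>2) / 8"
  have \<delta>: "\<delta> > 0"
    using z by (simp add: \<delta>_def power_less_one_iff abs_square_less_1)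
  have nz: "norm (z * cis (- (2 * pi * x))) = norm z" for x
    by (simp add: norm_mult)
  have pt: "1 / 2 + \<delta> \<le> Re (1 / (1 - w))" if "norm w = norm z" for w
  proof -
    define D where "D = (norm (1 - w))\<^sup>2"
    have "w \<noteq> 1"
      using that z by auto
    then have D: "D > 0"
      by (simp add: D_def)
    have "norm (1 - w) \<le> 2"
      using norm_triangle_ineq4[of 1 w] that z by simp
    then have D4: "D \<le> 4"
      using power_mono[of "norm (1 - w)" 2 2] by (simp add: D_def)
    have "Re (1 / (1 - w)) = (1 - Re w) / D"
      by (simp add: D_def Re_divide cmod_power2)
    also have "1 - Re w = (D + (1 - (norm w)\<^sup>2)) / 2"
      unfolding D_def cmod_power2 by (simp add: power2_eq_square algebra_simps)
    also have "\<dots> / D = 1 / 2 + (4 * \<delta>) / D"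
      using D that by (simp add: \<delta>_def field_simps)
    finally have "Re (1 / (1 - w)) = 1 / 2 + (4 * \<delta>) / D" .
    moreover have "\<delta> \<le> (4 * \<delta>) / D"
      using D D4 \<delta> by (simp add: field_simps)
    ultimately show ?thesis
      by simp
  qed
  have "1 / 2 + \<delta> = (\<integral>x. 1 / 2 + \<delta> \<partial>\<mu>)"
    by (simp add: prob_space)
  also have "\<dots> \<le> (\<integral>x. Re (1 / (1 - z * cis (- (2 * pi * x)))) \<partial>\<mu>)"
    by (intro integral_mono integrable_const integrable_Re integrable_cauchy_kernel z pt nz)
  also have "\<dots> = Re (mu_plus \<mu> z)"
    unfolding mu_plus_def by (rule integral_Re[OF integrable_cauchy_kernel[OF z]])
  finally show ?thesis
    using \<delta> by linarith
qed

end

section \<open>The normalized Cauchy transform in coordinates\<close>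

locale clark = circle_probability +
  fixes b :: "complex \<Rightarrow> complex"
  assumes herglotz: "herglotz_inner \<mu> b"
begin

lemma b_holomorphic: "b holomorphic_on ball 0 1"
  using herglotz by (auto simp: herglotz_inner_def inner_function_def)

lemma b_fps: "b has_fps_expansion fps_expansion b 0"
  by (rule has_fps_expansion_fps_expansion[OF _ _ b_holomorphic]) auto

text \<open>Division by 0 gives 0, so b z = 1 would make the left-hand side of the Herglotz identity
  0, whereas its right-hand side, 2 mu_plus - 1, has positive real part. The value 1 is thus
  excluded pointwise, without the maximum principle.\<close>

lemma
  assumes z: "norm z < 1"
  shows b_neq_1: "b z \<noteq> 1" and mu_plus_eq: "mu_plus \<mu> z = 1 / (1 - b z)"
proof -
  have pt: "(cis (2 * pi * x) + z) / (cis (2 * pi * x) - z) = 2 * (1 / (1 - z * cis (- (2 * pi * x)))) - 1" for x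
  proof -
    define w where "w = cis (2 * pi * x)"
    have w: "w \<noteq> 0" "cis (- (2 * pi * x)) = 1 / w"
      by (simp_all add: w_def divide_inverse flip: cis_inverse)
    have "w \<noteq> z"
      using z by (auto simp: w_def)
    then show ?thesis
      using w(1) unfolding w_def[symmetric] w(2) by (simp add: field_simps)
  qed
  have eq: "(1 + b z) / (1 - b z) = 2 * mu_plus \<mu> z - 1"
  proof -
    have "(\<integral>x. (cis (2 * pi * x) + z) / (cis (2 * pi * x) - z) \<partial>\<mu>) = 2 * mu_plus \<mu> z - 1"
    proof -
      have "(\<integral>x. (cis (2 * pi * x) + z) / (cis (2 * pi * x) - z) \<partial>\<mu>)
          = (\<integral>x. 2 * (1 / (1 - z * cis (- (2 * pi * x)))) \<partial>\<mu>) - (\<integral>x. 1 \<partial>\<mu>)"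
        unfolding pt using integrable_cauchy_kernel[OF z]
        by (intro Bochner_Integration.integral_diff integrable_mult_right integrable_const)
      then show ?thesis
        by (simp only: integral_mult_right_zero mu_plus_def) (simp add: prob_space)
    qed
    then show ?thesis
      using herglotz z by (simp add: herglotz_inner_def)
  qed
  moreover have "2 * mu_plus \<mu> z - 1 \<noteq> 0"
    using Re_mu_plus[OF z] by (auto simp: complex_eq_iff)
  ultimately show *: "b z \<noteq> 1"
    by auto
  define K where "K = 1 / (1 - b z)"
  have "(1 + b z) / (1 - b z) = 2 * K - 1"
    using * by (simp add: K_def field_simps)
  then have "mu_plus \<mu> z = K"
    using eq by simp
  then show "mu_plus \<mu> z = 1 / (1 - b z)"
    by (simp add: K_def)
qed

definition \<beta> :: "nat \<Rightarrow> complex" where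
  "\<beta> n = fps_nth (fps_expansion b 0) n"

definition \<alpha> :: "nat \<Rightarrow> complex" where
  "\<alpha> n = (if n = 0 then 1 else 0) - \<beta> n"

lemma eventually_ball_nhds_0: "\<forall>\<^sub>F z in nhds (0::complex). norm z < 1"
  using eventually_nhds_in_open[of "ball (0::complex) 1" 0] by simp

lemma inverse_mu_plus_fps: "(\<lambda>z. 1 / mu_plus \<mu> z) has_fps_expansion Abs_fps \<alpha>"
proof -
  have "(\<lambda>z. 1 - b z) has_fps_expansion (1 - fps_expansion b 0)"
    by (intro fps_expansion_intros b_fps)
  moreover have "1 - fps_expansion b 0 = Abs_fps \<alpha>"
    by (simp add: fps_eq_iff \<alpha>_def \<beta>_def)
  moreover have "\<forall>\<^sub>F z in nhds 0. 1 - b z = 1 / mu_plus \<mu> z"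
    using eventually_ball_nhds_0 by eventually_elim (simp add: mu_plus_eq b_neq_1)
  ultimately show ?thesis
    using has_fps_expansion_cong[of "\<lambda>z. 1 - b z" "\<lambda>z. 1 / mu_plus \<mu> z"] by simp
qed

lemma fps_expansion_inverse_mu_plus: "fps_expansion (\<lambda>z. 1 / mu_plus \<mu> z) 0 = Abs_fps \<alpha>"
  by (rule fps_expansion_eqI[OF inverse_mu_plus_fps])

abbreviation c :: "int \<Rightarrow> complex" where
  "c \<equiv> fourier_coeff (\<lambda>x. 1)"

text \<open>Comparison of coefficients in the product of mu_plus and its reciprocal, in the form
  that \<open>toeplitz_gram\<close> takes.\<close>

lemma \<alpha>_convolution: "(\<Sum>k\<le>m. \<alpha> (m - k) * c (int k)) = (if m = 0 then 1 else 0)"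
proof -
  have "(\<lambda>z. mu_plus \<mu> z * (1 / mu_plus \<mu> z)) has_fps_expansion Abs_fps (\<lambda>n. c (int n)) * Abs_fps \<alpha>"
    using cauchy_transform_fps[OF one_L2] inverse_mu_plus_fps
    unfolding mu_plus_def by (rule has_fps_expansion_mult)
  moreover have "\<forall>\<^sub>F z in nhds 0. mu_plus \<mu> z * (1 / mu_plus \<mu> z) = 1"
    using eventually_ball_nhds_0 by eventually_elim (simp add: mu_plus_eq b_neq_1)
  ultimately have "(\<lambda>z. 1) has_fps_expansion Abs_fps (\<lambda>n. c (int n)) * Abs_fps \<alpha>"
    using has_fps_expansion_cong[of "\<lambda>z. mu_plus \<mu> z * (1 / mu_plus \<mu> z)" "\<lambda>z. 1"] by blast
  moreover have "(\<lambda>z::complex. 1) has_fps_expansion 1"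
    by (rule has_fps_expansion_1)
  ultimately have "Abs_fps (\<lambda>n. c (int n)) * Abs_fps \<alpha> = 1"
    by (rule fps_expansion_unique_complex)
  from arg_cong[OF this, of "\<lambda>F. fps_nth F m"] show ?thesis
    by (simp only: fps_mult_nth fps_nth_Abs_fps atLeast0AtMost mult.commute[of "c _"]) simp
qed

lemma \<alpha>_0: "\<alpha> 0 = 1" and \<beta>_0: "\<beta> 0 = 0"
  using \<alpha>_convolution[of 0] by (simp_all add: fourier_coeff_1_0 \<alpha>_def)

text \<open>\<open>u n\<close> is the image of \<open>z ^ n\<close> under the adjoint of the normalized Cauchy transform.\<close>

definition u :: "nat \<Rightarrow> real \<Rightarrow> complex" where
  "u n x = (\<Sum>j\<le>n. cnj (\<alpha> (n - j)) * fourier_char (int j) x)"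

lemma u_L2: "u n \<in> L2 \<mu>"
  unfolding u_def[abs_def] by (intro L2_sum L2_cmult fourier_char_L2)

definition clark_coeff :: "(real \<Rightarrow> complex) \<Rightarrow> nat \<Rightarrow> complex" where
  "clark_coeff f n = (\<integral>x. f x * cnj (u n x) \<partial>\<mu>)"

lemma clark_coeff_eq:
  assumes "f \<in> L2 \<mu>"
  shows "clark_coeff f n = (\<Sum>j\<le>n. \<alpha> (n - j) * fourier_coeff f (int j))"
proof -
  have "clark_coeff f n = (\<integral>x. (\<Sum>j\<le>n. \<alpha> (n - j) * (f x * fourier_char (- int j) x)) \<partial>\<mu>)"
    unfolding clark_coeff_def u_def by (simp add: sum_distrib_left ac_simps)
  also have "\<dots> = (\<Sum>j\<le>n. \<integral>x. \<alpha> (n - j) * (f x * fourier_char (- int j) x) \<partial>\<mu>)"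
    by (intro Bochner_Integration.integral_sum integrable_mult_right integrable_mult_fourier_char assms)
  finally show ?thesis
    by (simp add: fourier_coeff_def)
qed

lemma series_over_mu_plus_nth: "fps_nth (series_over_mu_plus \<mu> a) n = (\<Sum>j\<le>n. \<alpha> (n - j) * a j)"
  by (simp only: series_over_mu_plus_def fps_expansion_inverse_mu_plus fps_mult_nth fps_nth_Abs_fps
      atLeast0AtMost mult.commute[of "a _"])

lemma series_over_mu_plus_inject:
  assumes "series_over_mu_plus \<mu> a = series_over_mu_plus \<mu> a'"
  shows "a = a'"
proof -
  have "Abs_fps \<alpha> \<noteq> 0"
    using \<alpha>_0 by (metis fps_nth_Abs_fps fps_zero_nth zero_neq_one)
  then have "Abs_fps a = Abs_fps a'"
    using assms by (simp add: series_over_mu_plus_def fps_expansion_inverse_mu_plus)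
  then show ?thesis
    by (simp add: fps_eq_iff fun_eq_iff)
qed

lemma normalized_cauchy_holomorphic:
  assumes "f \<in> L2 \<mu>"
  shows "normalized_cauchy \<mu> f holomorphic_on ball 0 1"
proof -
  have "(\<lambda>z. (1 - b z) * (\<integral>x. f x / (1 - z * cis (- (2 * pi * x))) \<partial>\<mu>)) holomorphic_on ball 0 1"
    by (intro holomorphic_intros b_holomorphic cauchy_transform_holomorphic assms)
  then show ?thesis
    by (rule holomorphic_transform) (simp add: normalized_cauchy_def mu_plus_eq b_neq_1)
qed

lemma normalized_cauchy_fps:
  assumes "f \<in> L2 \<mu>"
  shows "fps_expansion (normalized_cauchy \<mu> f) 0 = series_over_mu_plus \<mu> (\<lambda>n. fourier_coeff f (int n))"
proof (rule fps_expansion_eqI)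
  show "normalized_cauchy \<mu> f has_fps_expansion series_over_mu_plus \<mu> (\<lambda>n. fourier_coeff f (int n))"
    unfolding normalized_cauchy_def[abs_def] series_over_mu_plus_def fps_expansion_inverse_mu_plus
    by (subst mult.commute) (intro has_fps_expansion_mult cauchy_transform_fps assms inverse_mu_plus_fps)
qed

lemma normalized_cauchy_nth:
  assumes "f \<in> L2 \<mu>"
  shows "fps_nth (fps_expansion (normalized_cauchy \<mu> f) 0) n = clark_coeff f n"
  by (simp add: normalized_cauchy_fps series_over_mu_plus_nth clark_coeff_eq assms)

text \<open>The matrix of multiplication by \<open>b\<close> with respect to the monomials.\<close>

definition \<tau> :: "nat \<Rightarrow> nat \<Rightarrow> complex" where
  "\<tau> n j = (if j \<le> n then \<beta> (n - j) else 0)"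

text \<open>Since \<tau> is lower triangular, the entries of T T' with indices up to N involve only
  the columns up to N, so a common bound N can replace the minimum of n and m.\<close>

lemma gram_u:
  assumes "n \<le> N" "m \<le> N"
  shows "(\<integral>x. u n x * cnj (u m x) \<partial>\<mu>) = (if n = m then 1 else 0) - (\<Sum>j\<le>N. cnj (\<tau> n j) * \<tau> m j)"
proof -
  have "(\<integral>x. u n x * cnj (u m x) \<partial>\<mu>)
      = (\<integral>x. (\<Sum>j\<le>n. \<Sum>k\<le>m. cnj (\<alpha> (n - j)) * \<alpha> (m - k) * fourier_char (int j - int k) x) \<partial>\<mu>)"
    unfolding u_def
    by (simp add: sum_product ac_simps diff_conv_add_uminus fourier_char_add del: add_uminus_conv_diff)
  also have "\<dots> = (\<Sum>j\<le>n. \<Sum>k\<le>m. cnj (\<alpha> (n - j)) * \<alpha> (m - k) * c (int k - int j))"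
    using L2_integrable[OF finite_measure_axioms fourier_char_L2]
    by (simp add: fourier_coeff_def)
  also have "\<dots> = (if n = m then 1 else 0) - (\<Sum>j\<le>min n m. cnj (\<beta> (n - j)) * \<beta> (m - j))"
    by (rule toeplitz_gram[OF fourier_coeff_1_0 fourier_coeff_1_minus \<alpha>_convolution]) (simp add: \<alpha>_def)
  also have "(\<Sum>j\<le>min n m. cnj (\<beta> (n - j)) * \<beta> (m - j)) = (\<Sum>j\<le>N. cnj (\<tau> n j) * \<tau> m j)"
    using assms by (intro sum.mono_neutral_cong_left) (auto simp: \<tau>_def)
  finally show ?thesis .
qed

text \<open>The quadratic form |a|^2 - |T' a|^2 of the Gram matrix, with T' the adjoint of the
  finite section of \<tau>. Two contraction estimates come from it: dropping the second term bounds
  combinations of the u n, and nonnegativity of the left-hand side bounds T'.\<close>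

lemma norm_sum_u:
  "(\<integral>x. (norm (\<Sum>n\<le>N. a n * u n x))\<^sup>2 \<partial>\<mu>)
    = (\<Sum>n\<le>N. (norm (a n))\<^sup>2) - (\<Sum>j\<le>N. (norm (\<Sum>n\<le>N. a n * cnj (\<tau> n j)))\<^sup>2)"
proof -
  have "complex_of_real (\<integral>x. (norm (\<Sum>n\<le>N. a n * u n x))\<^sup>2 \<partial>\<mu>)
      = (\<integral>x. complex_of_real ((norm (\<Sum>n\<le>N. a n * u n x))\<^sup>2) \<partial>\<mu>)"
    by (rule integral_complex_of_real[symmetric])
  also have "\<dots> = (\<integral>x. (\<Sum>n\<le>N. \<Sum>m\<le>N. (a n * cnj (a m)) * (u n x * cnj (u m x))) \<partial>\<mu>)"
    by (simp only: complex_norm_square cnj_sum sum_product complex_cnj_mult) (simp add: ac_simps)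
  also have "\<dots> = (\<Sum>n\<le>N. \<Sum>m\<le>N. (a n * cnj (a m)) * (\<integral>x. u n x * cnj (u m x) \<partial>\<mu>))"
    using L2_integrable_mult[OF u_L2 L2_cnj[OF u_L2]] by simp
  also have "\<dots> = (\<Sum>n\<le>N. \<Sum>m\<le>N. (a n * cnj (a m)) * ((if n = m then 1 else 0) - (\<Sum>j\<le>N. cnj (\<tau> n j) * \<tau> m j)))"
    by (intro sum.cong refl) (simp add: gram_u[of _ N])
  also have "\<dots> = (\<Sum>n\<le>N. a n * cnj (a n))
      - (\<Sum>n\<le>N. \<Sum>m\<le>N. \<Sum>j\<le>N. (a n * cnj (\<tau> n j)) * cnj (a m * cnj (\<tau> m j)))"
  proof -
    have "(\<Sum>m\<le>N. (a n * cnj (a m)) * (if n = m then 1 else 0)) = a n * cnj (a n)" if "n \<in> {..N}" for n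
      using that by (subst sum.remove[of _ n]) (auto intro!: sum.neutral)
    then have "(\<Sum>n\<le>N. \<Sum>m\<le>N. (a n * cnj (a m)) * (if n = m then 1 else 0)) = (\<Sum>n\<le>N. a n * cnj (a n))"
      by (rule sum.cong[OF refl])
    moreover have "(a n * cnj (a m)) * (\<Sum>j\<le>N. cnj (\<tau> n j) * \<tau> m j)
        = (\<Sum>j\<le>N. (a n * cnj (\<tau> n j)) * cnj (a m * cnj (\<tau> m j)))" for n m
      by (simp add: sum_distrib_left ac_simps)
    ultimately show ?thesis
      by (simp only: right_diff_distrib sum_subtractf)
  qed
  also have "(\<Sum>n\<le>N. \<Sum>m\<le>N. \<Sum>j\<le>N. (a n * cnj (\<tau> n j)) * cnj (a m * cnj (\<tau> m j)))
      = (\<Sum>j\<le>N. \<Sum>n\<le>N. \<Sum>m\<le>N. (a n * cnj (\<tau> n j)) * cnj (a m * cnj (\<tau> m j)))"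
    by (rule trans[OF sum.cong[OF refl sum.swap] sum.swap])
  also have "\<dots> = (\<Sum>j\<le>N. (\<Sum>n\<le>N. a n * cnj (\<tau> n j)) * cnj (\<Sum>n\<le>N. a n * cnj (\<tau> n j)))"
    by (simp add: sum_product)
  also have "(\<Sum>n\<le>N. a n * cnj (a n)) - \<dots>
      = complex_of_real ((\<Sum>n\<le>N. (norm (a n))\<^sup>2) - (\<Sum>j\<le>N. (norm (\<Sum>n\<le>N. a n * cnj (\<tau> n j)))\<^sup>2))"
    by (simp only: of_real_diff of_real_sum complex_norm_square)
  finally show ?thesis
    by (simp only: of_real_eq_iff)
qed

lemma norm_sum_u_le: "(\<integral>x. (norm (\<Sum>n\<le>N. a n * u n x))\<^sup>2 \<partial>\<mu>) \<le> (\<Sum>n\<le>N. (norm (a n))\<^sup>2)"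
  unfolding norm_sum_u by (simp add: sum_nonneg)

text \<open>Contractivity of multiplication by b is obtained here from positivity of the measure
  rather than from |b| \<le> 1.\<close>

lemma adjoint_contraction:
  "(\<Sum>j\<le>N. (norm (\<Sum>n\<le>N. a n * cnj (\<tau> n j)))\<^sup>2) \<le> (\<Sum>n\<le>N. (norm (a n))\<^sup>2)"
proof -
  have "0 \<le> (\<integral>x. (norm (\<Sum>n\<le>N. a n * u n x))\<^sup>2 \<partial>\<mu>)"
    by simp
  then show ?thesis
    unfolding norm_sum_u by simp
qed

lemma sum_u_L2: "(\<lambda>x. \<Sum>n\<in>A. a n * u n x) \<in> L2 \<mu>"
  by (intro L2_sum L2_cmult u_L2)

lemma integral_mult_cnj_sum_u:
  assumes f: "f \<in> L2 \<mu>"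
  shows "(\<integral>x. f x * cnj (\<Sum>n\<in>A. a n * u n x) \<partial>\<mu>) = (\<Sum>n\<in>A. clark_coeff f n * cnj (a n))"
proof -
  have "(\<integral>x. f x * cnj (\<Sum>n\<in>A. a n * u n x) \<partial>\<mu>) = (\<integral>x. (\<Sum>n\<in>A. cnj (a n) * (f x * cnj (u n x))) \<partial>\<mu>)"
    by (simp add: sum_distrib_left ac_simps)
  also have "\<dots> = (\<Sum>n\<in>A. cnj (a n) * clark_coeff f n)"
    using L2_integrable_mult[OF f L2_cnj[OF u_L2]] by (simp add: clark_coeff_def)
  finally show ?thesis
    by (simp add: mult.commute)
qed

text \<open>The u n are not orthonormal; the estimate is dual to \<open>norm_sum_u_le\<close>. With
  S the sum on the left and A the integral on the right, pairing f with the combination whose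
  coefficients are those of f itself gives S^2 \<le> A S.\<close>

lemma bessel:
  assumes f: "f \<in> L2 \<mu>"
  shows "(\<Sum>n\<le>N. (norm (clark_coeff f n))\<^sup>2) \<le> (\<integral>x. (norm (f x))\<^sup>2 \<partial>\<mu>)"
proof -
  define g where "g = clark_coeff f"
  define S where "S = (\<Sum>n\<le>N. (norm (g n))\<^sup>2)"
  have S0: "S \<ge> 0"
    by (simp add: S_def sum_nonneg)
  have "complex_of_real S = (\<integral>x. f x * cnj (\<Sum>n\<le>N. g n * u n x) \<partial>\<mu>)"
    unfolding integral_mult_cnj_sum_u[OF f] by (simp only: S_def g_def of_real_sum complex_norm_square)
  then have "S\<^sup>2 = (norm (\<integral>x. f x * cnj (\<Sum>n\<le>N. g n * u n x) \<partial>\<mu>))\<^sup>2"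
    by (metis norm_of_real power2_abs)
  also have "\<dots> \<le> (\<integral>x. (norm (f x))\<^sup>2 \<partial>\<mu>) * (\<integral>x. (norm (\<Sum>n\<le>N. g n * u n x))\<^sup>2 \<partial>\<mu>)"
    using L2_Cauchy_Schwarz[OF f L2_cnj[OF sum_u_L2[where a = g and A = "{..N}"]]]
    by (simp only: complex_mod_cnj)
  also have "\<dots> \<le> (\<integral>x. (norm (f x))\<^sup>2 \<partial>\<mu>) * S"
    unfolding S_def by (intro mult_left_mono norm_sum_u_le) simp
  finally have "S * S \<le> (\<integral>x. (norm (f x))\<^sup>2 \<partial>\<mu>) * S"
    by (simp add: power2_eq_square)
  then have "S \<le> (\<integral>x. (norm (f x))\<^sup>2 \<partial>\<mu>)"
    using S0 by (cases "S = 0") auto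
  then show ?thesis
    by (simp add: S_def g_def)
qed

text \<open>Passage from the adjoint back to the matrix by the same duality: if a = T h, then |a|^2
  is the inner product of T' a and h.\<close>

lemma multiplication_contraction:
  "(\<Sum>n\<le>N. (norm (\<Sum>j\<le>N. \<tau> n j * h j))\<^sup>2) \<le> (\<Sum>j\<le>N. (norm (h j))\<^sup>2)"
proof -
  define a where "a n = (\<Sum>j\<le>N. \<tau> n j * h j)" for n
  define S where "S = (\<Sum>n\<le>N. (norm (a n))\<^sup>2)"
  define d where "d j = (\<Sum>n\<le>N. a n * cnj (\<tau> n j))" for j
  have S0: "S \<ge> 0"
    by (simp add: S_def sum_nonneg)
  have "complex_of_real S = (\<Sum>n\<le>N. \<Sum>j\<le>N. a n * cnj (\<tau> n j) * cnj (h j))"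
    by (simp only: S_def of_real_sum complex_norm_square)
      (subst (2) a_def, simp add: sum_distrib_left ac_simps)
  also have "\<dots> = (\<Sum>j\<le>N. d j * cnj (h j))"
    by (subst sum.swap) (simp add: d_def sum_distrib_right)
  finally have "S = norm (\<Sum>j\<le>N. d j * cnj (h j))"
    using S0 by (metis abs_of_nonneg norm_of_real)
  also have "\<dots> \<le> (\<Sum>j\<le>N. norm (d j) * norm (h j))"
    by (rule order_trans[OF norm_sum]) (simp add: norm_mult)
  finally have "S\<^sup>2 \<le> (\<Sum>j\<le>N. norm (d j) * norm (h j))\<^sup>2"
    using S0 by (intro power_mono) auto
  also have "\<dots> \<le> (\<Sum>j\<le>N. (norm (d j))\<^sup>2) * (\<Sum>j\<le>N. (norm (h j))\<^sup>2)"
    by (rule Cauchy_Schwarz_ineq_sum)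
  also have "\<dots> \<le> S * (\<Sum>j\<le>N. (norm (h j))\<^sup>2)"
    unfolding S_def d_def by (intro mult_right_mono adjoint_contraction) (simp add: sum_nonneg)
  finally have "S * S \<le> S * (\<Sum>j\<le>N. (norm (h j))\<^sup>2)"
    by (simp add: power2_eq_square)
  then have "S \<le> (\<Sum>j\<le>N. (norm (h j))\<^sup>2)"
    using S0 by (cases "S = 0") (auto simp: sum_nonneg)
  then show ?thesis
    by (simp add: S_def a_def)
qed

text \<open>The \<beta> n form column 0 of \<tau>, the image of the constant function 1 under
  multiplication by b.\<close>

lemma sum_norm_\<beta>_le: "(\<Sum>n\<le>N. (norm (\<beta> n))\<^sup>2) \<le> 1"
proof -
  have "(\<Sum>j\<le>N. \<tau> n j * (if j = 0 then 1 else 0)) = \<beta> n" for n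
    by (subst sum.remove[of _ 0]) (auto simp: \<tau>_def intro!: sum.neutral)
  then have "(\<Sum>n\<le>N. (norm (\<beta> n))\<^sup>2) = (\<Sum>n\<le>N. (norm (\<Sum>j\<le>N. \<tau> n j * (if j = 0 then 1 else 0)))\<^sup>2)"
    by simp
  also have "\<dots> \<le> (\<Sum>j\<le>N. (norm (if j = 0 then 1 else 0 :: complex))\<^sup>2)"
    by (rule multiplication_contraction)
  also have "\<dots> = (\<Sum>j\<le>N. if j = 0 then 1 else 0)"
    by (intro sum.cong) auto
  also have "\<dots> = 1"
    by simp
  finally show ?thesis .
qed

lemma summable_\<beta>: "summable (\<lambda>n. (norm (\<beta> n))\<^sup>2)"
  using sum_norm_\<beta>_le by (intro bounded_imp_summable[where B = 1]) auto

end

section \<open>Parseval's identity\<close>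

definition circle_lebesgue :: "real measure" where
  "circle_lebesgue = restrict_space lborel {-1/2<..<1/2}"

lemma circle_probability_lebesgue: "circle_probability circle_lebesgue"
proof (rule circle_probability.intro)
  show "prob_space circle_lebesgue"
    unfolding circle_lebesgue_def by (rule prob_spaceI) (simp add: space_restrict_space emeasure_restrict_space)
  show "sets circle_lebesgue = sets circle_borel"
    unfolding circle_borel_def circle_lebesgue_def by (intro sets_restrict_space_cong) simp
qed

lemma integral_fourier_char_lebesgue:
  "(\<integral>x. fourier_char n x \<partial>circle_lebesgue) = (if n = 0 then 1 else 0)"
proof (cases "n = 0")
  case True
  interpret circle_probability circle_lebesgue
    by (rule circle_probability_lebesgue)
  show ?thesis
    using True prob_space by simp
next
  case False
  define F where "F x = fourier_char n x / (2 * of_real pi * \<i> * of_int n)" for x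
  have Fd: "(F has_vector_derivative fourier_char n x) (at x within A)" for x A
  proof -
    define G where "G z = exp (2 * of_real pi * \<i> * of_int n * z) / (2 * of_real pi * \<i> * of_int n)" for z
    have "(G has_field_derivative exp (2 * of_real pi * \<i> * of_int n * of_real x)) (at (of_real x))"
      unfolding G_def using False by (auto intro!: derivative_eq_intros)
    then have "((\<lambda>x. G (of_real x)) has_vector_derivative exp (2 * of_real pi * \<i> * of_int n * of_real x)) (at x within A)"
      by (rule has_vector_derivative_real_field)
    then show ?thesis
      by (simp add: F_def[abs_def] G_def fourier_char_def cis_conv_exp ac_simps)
  qed
  have "has_bochner_integral lborel (\<lambda>x. indicator {-1/2..1/2} x *\<^sub>R fourier_char n x) (F (1/2) - F (-1/2))"
  proof (rule has_bochner_integral_FTC_Icc)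
    show "continuous_on {- 1 / 2..1 / 2} (fourier_char n)"
      unfolding fourier_char_def cis_conv_exp by (intro continuous_intros)
  qed (simp_all add: Fd)
  moreover have "F (1/2) - F (-1/2) = 0"
  proof -
    have "fourier_char n (1/2) = fourier_char n (-1/2)"
      by (auto simp: fourier_char_def complex_eq_iff mult.commute[of pi] sin_zero_iff_int2)
    then show ?thesis
      by (simp add: F_def)
  qed
  ultimately have "(\<integral>x. indicator {-1/2..1/2} x *\<^sub>R fourier_char n x \<partial>lborel) = 0"
    by (simp add: has_bochner_integral_integral_eq)
  also have "(\<integral>x. indicator {-1/2..1/2} x *\<^sub>R fourier_char n x \<partial>lborel)
      = (\<integral>x. indicator {-1/2<..<1/2} x *\<^sub>R fourier_char n x \<partial>lborel)"
  proof (rule integral_cong_AE)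
    show "AE x in lborel. indicator {-1/2..1/2} x *\<^sub>R fourier_char n x = indicator {-1/2<..<1/2} x *\<^sub>R fourier_char n x"
      using AE_lborel_singleton[of "-1/2"] AE_lborel_singleton[of "1/2"]
      by eventually_elim (auto simp: indicator_def)
  qed auto
  also have "\<dots> = (\<integral>x. fourier_char n x \<partial>circle_lebesgue)"
    unfolding circle_lebesgue_def by (subst integral_restrict_space) auto
  finally show ?thesis
    using False by simp
qed

text \<open>On a circle of radius r < 1 the Taylor series converges absolutely, which dominates the
  partial sums; for these the identity is orthonormality of the characters.\<close>

lemma parseval:
  assumes h: "h holomorphic_on ball 0 1" and r: "0 \<le> r" "r < 1"
  shows "(\<lambda>n. (norm (fps_nth (fps_expansion h 0) n))\<^sup>2 * r ^ (2 * n))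
    sums (\<integral>x. (norm (h (of_real r * cis (2 * pi * x))))\<^sup>2 \<partial>circle_lebesgue)"
proof -
  interpret circle_probability circle_lebesgue
    by (rule circle_probability_lebesgue)
  define \<eta> where "\<eta> n = fps_nth (fps_expansion h 0) n" for n
  have hs: "(\<lambda>n. \<eta> n * z ^ n) sums h z" if "norm z < 1" for z
    using holomorphic_power_series[OF h] that by (simp add: \<eta>_def fps_expansion_def)
  define P where "P N x = (\<Sum>n<N. (\<eta> n * of_real r ^ n) * fourier_char (int n) x)" for N x
  have P_L2: "P N \<in> L2 circle_lebesgue" for N
    unfolding P_def[abs_def] by (intro L2_sum L2_cmult fourier_char_L2)
  have Plim: "(\<lambda>N. P N x) \<longlonglongrightarrow> h (of_real r * cis (2 * pi * x))" for x
  proof -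
    have "norm (of_real r * cis (2 * pi * x)) < 1"
      using r by (simp add: norm_mult)
    from hs[OF this] have "(\<lambda>n. (\<eta> n * of_real r ^ n) * fourier_char (int n) x) sums h (of_real r * cis (2 * pi * x))"
      by (simp add: power_mult_distrib Complex.DeMoivre fourier_char_def ac_simps)
    then show ?thesis
      by (simp add: sums_def P_def)
  qed
  have sm: "summable (\<lambda>n. norm (\<eta> n) * r ^ n)"
  proof -
    \<comment> \<open>Convergence at a radius strictly between r and 1 yields absolute convergence
      at r.\<close>
    define s where "s = (1 + r) / 2"
    have s: "r < s" "s < 1"
      using r by (auto simp: s_def)
    have "summable (\<lambda>n. \<eta> n * of_real s ^ n)"
      using hs[of "of_real s"] s r by (auto simp: sums_iff)
    then have "summable (\<lambda>n. norm (\<eta> n * of_real r ^ n))"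
      by (rule powser_insidea) (use s r in auto)
    then show ?thesis
      using r by (simp add: norm_mult norm_power)
  qed
  define B where "B = (\<Sum>n. norm (\<eta> n) * r ^ n)"
  have PB: "norm (P N x) \<le> B" for N x
  proof -
    have "norm (P N x) \<le> (\<Sum>n<N. norm (\<eta> n) * r ^ n)"
      unfolding P_def by (rule order_trans[OF norm_sum]) (use r in \<open>simp add: norm_mult norm_power\<close>)
    also have "\<dots> \<le> B"
      unfolding B_def by (rule sum_le_suminf[OF sm]) (use r in auto)
    finally show ?thesis .
  qed
  have "(\<integral>x. (norm (P N x))\<^sup>2 \<partial>circle_lebesgue) = (\<Sum>n<N. (norm (\<eta> n))\<^sup>2 * r ^ (2 * n))" for N
  proof -
    define a where "a n = \<eta> n * of_real r ^ n" for n
    have "complex_of_real (\<integral>x. (norm (P N x))\<^sup>2 \<partial>circle_lebesgue)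
        = (\<integral>x. complex_of_real ((norm (P N x))\<^sup>2) \<partial>circle_lebesgue)"
      by (rule integral_complex_of_real[symmetric])
    also have "\<dots> = (\<integral>x. (\<Sum>n<N. \<Sum>m<N. (a n * cnj (a m)) * fourier_char (int n - int m) x) \<partial>circle_lebesgue)"
      unfolding P_def a_def[symmetric] complex_norm_square cnj_sum sum_product complex_cnj_mult
        diff_conv_add_uminus fourier_char_add cnj_fourier_char
      by (simp add: ac_simps)
    also have "\<dots> = (\<Sum>n<N. \<Sum>m<N. (a n * cnj (a m)) * (if n = m then 1 else 0))"
      using L2_integrable[OF finite_measure_axioms fourier_char_L2]
      by (simp add: integral_fourier_char_lebesgue)
    also have "\<dots> = (\<Sum>n<N. a n * cnj (a n))"
    proof (rule sum.cong[OF refl])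
      fix n assume "n \<in> {..<N}"
      then show "(\<Sum>m<N. (a n * cnj (a m)) * (if n = m then 1 else 0)) = a n * cnj (a n)"
        by (subst sum.remove[of _ n]) (auto intro!: sum.neutral)
    qed
    also have "\<dots> = complex_of_real (\<Sum>n<N. (norm (a n))\<^sup>2)"
      by (simp only: of_real_sum complex_norm_square)
    also have "(\<Sum>n<N. (norm (a n))\<^sup>2) = (\<Sum>n<N. (norm (\<eta> n))\<^sup>2 * r ^ (2 * n))"
      using r by (simp add: a_def norm_mult norm_power power_mult_distrib power_mult[symmetric] mult.commute)
    finally show ?thesis
      by (simp only: of_real_eq_iff)
  qed
  moreover have "(\<lambda>N. \<integral>x. (norm (P N x))\<^sup>2 \<partial>circle_lebesgue)
      \<longlonglongrightarrow> (\<integral>x. (norm (h (of_real r * cis (2 * pi * x))))\<^sup>2 \<partial>circle_lebesgue)"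
  proof (rule integral_dominated_convergence[where w = "\<lambda>x. B\<^sup>2"])
    have meas: "P N \<in> borel_measurable circle_lebesgue" for N
      using P_L2 by (simp add: L2_def)
    then show "(\<lambda>x. (norm (P N x))\<^sup>2) \<in> borel_measurable circle_lebesgue" for N
      by simp
    have "(\<lambda>x. h (of_real r * cis (2 * pi * x))) \<in> borel_measurable circle_lebesgue"
      by (rule borel_measurable_LIMSEQ_metric[OF meas Plim])
    then show "(\<lambda>x. (norm (h (of_real r * cis (2 * pi * x))))\<^sup>2) \<in> borel_measurable circle_lebesgue"
      by simp
    show "AE x in circle_lebesgue. (\<lambda>N. (norm (P N x))\<^sup>2) \<longlonglongrightarrow> (norm (h (of_real r * cis (2 * pi * x))))\<^sup>2"
      by (intro AE_I2 tendsto_intros Plim)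
    show "AE x in circle_lebesgue. norm ((norm (P N x))\<^sup>2) \<le> B\<^sup>2" for N
      using PB by (auto intro!: power_mono)
  qed simp
  ultimately show ?thesis
    by (simp add: sums_def \<eta>_def)
qed

text \<open>Unimodular radial limits make the means of |b|^2 over circles tend to 1 as the radius
  tends to 1, and by \<open>parseval\<close> every such mean is at most the sum. This is where the
  boundary values of b enter.\<close>

lemma inner_function_norm:
  assumes b: "inner_function b" and sm: "summable (\<lambda>n. (norm (fps_nth (fps_expansion b 0) n))\<^sup>2)"
  shows "(\<Sum>n. (norm (fps_nth (fps_expansion b 0) n))\<^sup>2) \<ge> 1"
proof -
  interpret circle_probability circle_lebesgue
    by (rule circle_probability_lebesgue)
  define \<eta> where "\<eta> n = fps_nth (fps_expansion b 0) n" for n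
  have hol: "b holomorphic_on ball 0 1" and bd: "\<And>z. norm z < 1 \<Longrightarrow> norm (b z) \<le> 1"
    using b by (auto simp: inner_function_def)
  define r where "r k = 1 - 1 / real (k + 2)" for k :: nat
  have r: "0 \<le> r k" "r k < 1" for k
    by (auto simp: r_def field_simps)
  have "filterlim r (at_left 1) sequentially"
  proof (rule tendsto_imp_filterlim_at_left)
    show "r \<longlonglongrightarrow> 1"
      unfolding r_def by real_asymp
    show "\<forall>\<^sub>F k in sequentially. r k < 1"
      using r by simp
  qed
  define I where "I k = (\<integral>x. (norm (b (of_real (r k) * cis (2 * pi * x))))\<^sup>2 \<partial>circle_lebesgue)" for k
  have "I \<longlonglongrightarrow> (\<integral>x. 1 \<partial>circle_lebesgue)"
    unfolding I_def[abs_def]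
  proof (rule integral_dominated_convergence[where w = "\<lambda>x. 1"])
    show "(\<lambda>x. (norm (b (of_real (r k) * cis (2 * pi * x))))\<^sup>2) \<in> borel_measurable circle_lebesgue" for k
    proof (rule borel_measurable_circle, rule borel_measurable_continuous_onI)
      have "continuous_on UNIV (\<lambda>x. b (of_real (r k) * cis (2 * pi * x)))"
        using r by (intro continuous_on_compose2[OF holomorphic_on_imp_continuous_on[OF hol]] continuous_intros)
          (auto simp: norm_mult)
      then show "continuous_on UNIV (\<lambda>x. (norm (b (of_real (r k) * cis (2 * pi * x))))\<^sup>2)"
        by (intro continuous_intros)
    qed
    show "AE x in circle_lebesgue. norm ((norm (b (of_real (r k) * cis (2 * pi * x))))\<^sup>2) \<le> 1" for k
      using bd r by (auto intro!: power_le_one simp: norm_mult)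
    have "AE x in lborel. x \<in> {-1/2<..<1/2} \<longrightarrow>
        (\<exists>w. norm w = 1 \<and> ((\<lambda>r. b (of_real r * cis (2 * pi * x))) \<longlongrightarrow> w) (at_left 1))"
      using b by (simp add: inner_function_def)
    then have "AE x in circle_lebesgue.
        (\<exists>w. norm w = 1 \<and> ((\<lambda>r. b (of_real r * cis (2 * pi * x))) \<longlongrightarrow> w) (at_left 1))"
      unfolding circle_lebesgue_def by (subst AE_restrict_space_iff) auto
    then show "AE x in circle_lebesgue. (\<lambda>k. (norm (b (of_real (r k) * cis (2 * pi * x))))\<^sup>2) \<longlonglongrightarrow> 1"
    proof eventually_elim
      case (elim x)
      then obtain w where w: "norm w = 1" "((\<lambda>r. b (of_real r * cis (2 * pi * x))) \<longlongrightarrow> w) (at_left 1)"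
        by blast
      from filterlim_compose[OF w(2) \<open>filterlim r (at_left 1) sequentially\<close>]
      have "(\<lambda>k. (norm (b (of_real (r k) * cis (2 * pi * x))))\<^sup>2) \<longlonglongrightarrow> (norm w)\<^sup>2"
        by (intro tendsto_intros)
      then show ?case
        using w by simp
    qed
  qed simp_all
  moreover have "I k \<le> (\<Sum>n. (norm (\<eta> n))\<^sup>2)" for k
  proof -
    have "(\<lambda>n. (norm (\<eta> n))\<^sup>2 * r k ^ (2 * n)) sums I k"
      unfolding I_def \<eta>_def by (rule parseval[OF hol r])
    then show ?thesis
    proof (rule sums_le[rotated])
      show "(\<lambda>n. (norm (\<eta> n))\<^sup>2) sums (\<Sum>n. (norm (\<eta> n))\<^sup>2)"
        unfolding \<eta>_def by (rule summable_sums[OF sm])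
      show "(norm (\<eta> n))\<^sup>2 * r k ^ (2 * n) \<le> (norm (\<eta> n))\<^sup>2" for n
        using r[of k] by (intro mult_left_le power_le_one) auto
    qed
  qed
  ultimately have "(\<integral>x. 1 \<partial>circle_lebesgue) \<le> (\<Sum>n. (norm (\<eta> n))\<^sup>2)"
    by (intro LIMSEQ_le_const2[of I]) auto
  then show ?thesis
    using prob_space by (simp add: \<eta>_def)
qed

context clark
begin

text \<open>Contractivity gives one inequality, the boundary values give the other. Shifted by k,
  the same sum is the squared norm of b z^k.\<close>

lemma \<beta>_sums: "(\<lambda>n. (norm (\<beta> n))\<^sup>2) sums 1"
proof -
  have "(\<Sum>n. (norm (\<beta> n))\<^sup>2) \<le> 1"
  proof (rule suminf_le_const[OF summable_\<beta>])
    show "(\<Sum>n<N. (norm (\<beta> n))\<^sup>2) \<le> 1" for N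
      by (rule order_trans[OF sum_mono2 sum_norm_\<beta>_le[of N]]) auto
  qed
  moreover have "(\<Sum>n. (norm (\<beta> n))\<^sup>2) \<ge> 1"
    using inner_function_norm[of b] herglotz summable_\<beta> by (simp add: herglotz_inner_def \<beta>_def)
  ultimately show ?thesis
    using summable_sums[OF summable_\<beta>] by simp
qed

end

section \<open>Clark's theorem: range\<close>

text \<open>Bounded in l^2 and null in each coordinate means weakly null. The pairing is cut off at
  N because \<open>S N\<close> stands for a section whose size grows with N.\<close>

lemma weak_l2_limit:
  fixes S :: "nat \<Rightarrow> nat \<Rightarrow> complex" and h :: "nat \<Rightarrow> complex"
  assumes S0: "\<And>k. (\<lambda>N. S N k) \<longlonglongrightarrow> 0"
    and SB: "\<And>N. (\<Sum>k\<le>N. (norm (S N k))\<^sup>2) \<le> B"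
    and h: "summable (\<lambda>k. (norm (h k))\<^sup>2)"
  shows "(\<lambda>N. \<Sum>k\<le>N. S N k * cnj (h k)) \<longlonglongrightarrow> 0"
proof (rule LIMSEQ_I)
  fix e :: real assume e: "e > 0"
  have B: "B \<ge> 0"
    using order_trans[OF _ SB[of 0]] by (simp add: sum_nonneg)
  \<comment> \<open>Cauchy-Schwarz bounds the tail by the square root of B \<delta>, which is at
    most e / 2; the summand 1 guards against B = 0.\<close>
  define \<delta> where "\<delta> = (e / 2)\<^sup>2 / (B + 1)"
  have \<delta>: "\<delta> > 0"
    using e B by (simp add: \<delta>_def)
  obtain K where K: "\<And>m n. m \<ge> K \<Longrightarrow> norm (\<Sum>k=m..<n. (norm (h k))\<^sup>2) < \<delta>"
    using h \<delta> unfolding summable_Cauchy by blast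
  have "(\<lambda>N. \<Sum>k<K. S N k * cnj (h k)) \<longlonglongrightarrow> (\<Sum>k<K. 0 * cnj (h k))"
    by (intro tendsto_sum tendsto_mult S0 tendsto_const)
  then have "(\<lambda>N. \<Sum>k<K. S N k * cnj (h k)) \<longlonglongrightarrow> 0"
    by simp
  from LIMSEQ_D[OF this, of "e / 2"] e obtain M
    where M: "\<And>N. N \<ge> M \<Longrightarrow> norm (\<Sum>k<K. S N k * cnj (h k)) < e / 2"
    by auto
  show "\<exists>no. \<forall>N\<ge>no. norm ((\<Sum>k\<le>N. S N k * cnj (h k)) - 0) < e"
  proof (intro exI allI impI)
    fix N assume N: "N \<ge> max M K"
    define R where "R = (\<Sum>k=K..<Suc N. norm (S N k) * norm (h k))"
    have "R\<^sup>2 \<le> (\<Sum>k=K..<Suc N. (norm (S N k))\<^sup>2) * (\<Sum>k=K..<Suc N. (norm (h k))\<^sup>2)"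
      unfolding R_def by (rule Cauchy_Schwarz_ineq_sum)
    also have "\<dots> \<le> B * \<delta>"
    proof (rule mult_mono)
      show "(\<Sum>k=K..<Suc N. (norm (S N k))\<^sup>2) \<le> B"
        by (rule order_trans[OF sum_mono2 SB[of N]]) auto
      show "(\<Sum>k=K..<Suc N. (norm (h k))\<^sup>2) \<le> \<delta>"
        using K[of K "Suc N"] by simp
    qed (use B in \<open>auto simp: sum_nonneg\<close>)
    also have "\<dots> \<le> (e / 2)\<^sup>2"
      using B by (simp add: \<delta>_def field_simps mult_right_mono)
    finally have R: "R \<le> e / 2"
      by (rule power2_le_imp_le) (use e in simp)
    have "(\<Sum>k\<le>N. S N k * cnj (h k)) = (\<Sum>k<K. S N k * cnj (h k)) + (\<Sum>k=K..<Suc N. S N k * cnj (h k))"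
      using N sum.atLeastLessThan_concat[of 0 K "Suc N" "\<lambda>k. S N k * cnj (h k)"]
      by (simp add: atLeast0LessThan lessThan_Suc_atMost)
    moreover have "norm (\<Sum>k=K..<Suc N. S N k * cnj (h k)) \<le> R"
      unfolding R_def by (rule order_trans[OF norm_sum]) (simp add: norm_mult)
    ultimately show "norm ((\<Sum>k\<le>N. S N k * cnj (h k)) - 0) < e"
      using M[of N] N R norm_triangle_ineq[of "\<Sum>k<K. S N k * cnj (h k)" "\<Sum>k=K..<Suc N. S N k * cnj (h k)"]
      by simp
  qed
qed

lemma L2_norm_diff:
  assumes f: "f \<in> L2 M" and g: "g \<in> L2 M"
  shows "(\<integral>x. (norm (f x - g x))\<^sup>2 \<partial>M)
    = (\<integral>x. (norm (f x))\<^sup>2 \<partial>M) - 2 * Re (\<integral>x. f x * cnj (g x) \<partial>M) + (\<integral>x. (norm (g x))\<^sup>2 \<partial>M)"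
proof -
  have fg: "integrable M (\<lambda>x. f x * cnj (g x))"
    by (intro L2_integrable_mult f L2_cnj g)
  have "(norm (f x - g x))\<^sup>2 = (norm (f x))\<^sup>2 - 2 * Re (f x * cnj (g x)) + (norm (g x))\<^sup>2" for x
    unfolding cmod_power2 by (simp add: power2_eq_square algebra_simps)
  then have "(\<integral>x. (norm (f x - g x))\<^sup>2 \<partial>M)
      = (\<integral>x. (norm (f x))\<^sup>2 - 2 * Re (f x * cnj (g x)) + (norm (g x))\<^sup>2 \<partial>M)"
    by presburger
  also have "\<dots> = (\<integral>x. (norm (f x))\<^sup>2 - 2 * Re (f x * cnj (g x)) \<partial>M) + (\<integral>x. (norm (g x))\<^sup>2 \<partial>M)"
    by (intro Bochner_Integration.integral_add Bochner_Integration.integrable_diff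
        integrable_mult_right integrable_Re fg L2_integrable_square f g)
  also have "(\<integral>x. (norm (f x))\<^sup>2 - 2 * Re (f x * cnj (g x)) \<partial>M)
      = (\<integral>x. (norm (f x))\<^sup>2 \<partial>M) - (\<integral>x. 2 * Re (f x * cnj (g x)) \<partial>M)"
    by (intro Bochner_Integration.integral_diff integrable_mult_right integrable_Re fg L2_integrable_square f)
  also have "(\<integral>x. 2 * Re (f x * cnj (g x)) \<partial>M) = 2 * Re (\<integral>x. f x * cnj (g x) \<partial>M)"
    by (simp only: integral_mult_right_zero integral_Re[OF fg])
  finally show ?thesis .
qed

lemma holomorphic_fps_expansion_unique:
  assumes f: "f holomorphic_on ball 0 1" and g: "g holomorphic_on ball 0 1"
    and eq: "fps_expansion f 0 = fps_expansion g 0" and z: "z \<in> ball 0 1"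
  shows "f z = g z"
proof -
  have "(\<lambda>n. fps_nth (fps_expansion h 0) n * z ^ n) sums h z" if "h holomorphic_on ball 0 1" for h
    using holomorphic_power_series[OF that z] by (simp add: fps_expansion_def)
  from this[OF f] this[OF g] show ?thesis
    unfolding eq by (rule sums_unique2)
qed

context clark
begin

lemma \<tau>_column_sums: "(\<lambda>n. (norm (\<tau> n k))\<^sup>2) sums 1"
proof -
  have "(\<lambda>n. (norm (\<tau> (n + k) k))\<^sup>2) sums 1"
    using \<beta>_sums by (simp add: \<tau>_def)
  then show ?thesis
    by (subst (asm) sums_zero_iff_shift) (auto simp: \<tau>_def)
qed

text \<open>The adjoint of multiplication by \<open>b\<close> maps \<open>b * z ^ k\<close> to \<open>z ^ k\<close>, which makes the right-hand
  side of \<open>norm_sum_u\<close> vanish in the limit.\<close>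

lemma clark_coeff_orthogonal:
  assumes f: "f \<in> L2 \<mu>"
  shows "(\<lambda>N. \<Sum>n\<le>N. clark_coeff f n * cnj (\<tau> n k)) \<longlonglongrightarrow> 0"
proof -
  define s where "s N = (\<Sum>n\<le>N. (norm (\<tau> n k))\<^sup>2)" for N
  define A where "A = (\<integral>x. (norm (f x))\<^sup>2 \<partial>\<mu>)"
  have s: "s \<longlonglongrightarrow> 1"
    using \<tau>_column_sums[of k] by (simp add: sums_def_le s_def[abs_def])
  have bound: "(norm (\<Sum>n\<le>N. clark_coeff f n * cnj (\<tau> n k)))\<^sup>2 \<le> A * (s N - (s N)\<^sup>2)" if N: "N \<ge> k" for N
  proof -
    have "(norm (\<Sum>n\<le>N. clark_coeff f n * cnj (\<tau> n k)))\<^sup>2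
        = (norm (\<integral>x. f x * cnj (\<Sum>n\<le>N. \<tau> n k * u n x) \<partial>\<mu>))\<^sup>2"
      by (simp only: integral_mult_cnj_sum_u[OF f])
    also have "\<dots> \<le> A * (\<integral>x. (norm (\<Sum>n\<le>N. \<tau> n k * u n x))\<^sup>2 \<partial>\<mu>)"
      using L2_Cauchy_Schwarz[OF f L2_cnj[OF sum_u_L2[where a = "\<lambda>n. \<tau> n k" and A = "{..N}"]]]
      by (simp only: complex_mod_cnj A_def)
    also have "(\<integral>x. (norm (\<Sum>n\<le>N. \<tau> n k * u n x))\<^sup>2 \<partial>\<mu>)
        = s N - (\<Sum>j\<le>N. (norm (\<Sum>n\<le>N. \<tau> n k * cnj (\<tau> n j)))\<^sup>2)"
      by (simp only: norm_sum_u s_def)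
    \<comment> \<open>Of the sum over j only the term j = k is kept, where the inner product is s N
      itself. As s N tends to 1, the difference s N - (s N)^2 tends to 0.\<close>
    also have "A * \<dots> \<le> A * (s N - (s N)\<^sup>2)"
    proof -
      have "(\<Sum>n\<le>N. \<tau> n k * cnj (\<tau> n k)) = complex_of_real (s N)"
        by (simp only: s_def of_real_sum complex_norm_square)
      then have "(s N)\<^sup>2 = (norm (\<Sum>n\<le>N. \<tau> n k * cnj (\<tau> n k)))\<^sup>2"
        by simp
      also have "\<dots> \<le> (\<Sum>j\<le>N. (norm (\<Sum>n\<le>N. \<tau> n k * cnj (\<tau> n j)))\<^sup>2)"
        using N by (intro member_le_sum[where f = "\<lambda>j. (norm (\<Sum>n\<le>N. \<tau> n k * cnj (\<tau> n j)))\<^sup>2"]) auto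
      finally show ?thesis
        by (intro mult_left_mono) (auto simp: A_def)
    qed
    finally show ?thesis .
  qed
  have "(\<lambda>N. (norm (\<Sum>n\<le>N. clark_coeff f n * cnj (\<tau> n k)))\<^sup>2) \<longlonglongrightarrow> 0"
  proof (rule tendsto_sandwich[OF _ _ tendsto_const])
    have "(\<lambda>N. A * (s N - (s N)\<^sup>2)) \<longlonglongrightarrow> A * (1 - 1\<^sup>2)"
      by (intro tendsto_intros s)
    then show "(\<lambda>N. A * (s N - (s N)\<^sup>2)) \<longlonglongrightarrow> 0"
      by simp
    show "\<forall>\<^sub>F N in sequentially. (norm (\<Sum>n\<le>N. clark_coeff f n * cnj (\<tau> n k)))\<^sup>2 \<le> A * (s N - (s N)\<^sup>2)"
      using eventually_ge_at_top[of k] by eventually_elim (rule bound)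
  qed simp
  then have "(\<lambda>N. sqrt ((norm (\<Sum>n\<le>N. clark_coeff f n * cnj (\<tau> n k)))\<^sup>2)) \<longlonglongrightarrow> sqrt 0"
    by (rule tendsto_real_sqrt)
  then show ?thesis
    by (simp add: tendsto_norm_zero_iff)
qed

lemma mult_b_nth:
  assumes "H holomorphic_on ball 0 1"
  shows "fps_nth (fps_expansion (\<lambda>z. b z * H z) 0) n = (\<Sum>j\<le>n. \<tau> n j * fps_nth (fps_expansion H 0) j)"
proof -
  have "H has_fps_expansion fps_expansion H 0"
    by (rule has_fps_expansion_fps_expansion[OF _ _ assms]) auto
  then have "(\<lambda>z. b z * H z) has_fps_expansion (fps_expansion b 0 * fps_expansion H 0)"
    by (intro has_fps_expansion_mult b_fps)
  then have "fps_expansion (\<lambda>z. b z * H z) 0 = fps_expansion H 0 * fps_expansion b 0"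
    by (simp add: fps_expansion_eqI mult.commute)
  then show ?thesis
    by (simp only: fps_mult_nth atLeast0AtMost) (auto intro!: sum.cong simp: \<tau>_def \<beta>_def)
qed

lemma mult_b_nth':
  assumes "H holomorphic_on ball 0 1" "n \<le> N"
  shows "fps_nth (fps_expansion (\<lambda>z. b z * H z) 0) n = (\<Sum>j\<le>N. \<tau> n j * fps_nth (fps_expansion H 0) j)"
  unfolding mult_b_nth[OF assms(1)] using assms(2)
  by (intro sum.mono_neutral_left) (auto simp: \<tau>_def)

text \<open>Bessel's inequality gives square summability. For orthogonality, T is moved from h to
  the coefficients g: the sections of T' g are bounded in l^2 and tend to 0 in each coordinate,
  hence weakly.\<close>

theorem normalized_cauchy_in_model_space:
  assumes f: "f \<in> L2 \<mu>"
  shows "normalized_cauchy \<mu> f \<in> model_space b"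
proof -
  define g where "g n = clark_coeff f n" for n
  have gn: "fps_nth (fps_expansion (normalized_cauchy \<mu> f) 0) n = g n" for n
    by (simp add: normalized_cauchy_nth f g_def)
  have "summable (\<lambda>n. (norm (g n))\<^sup>2)"
    by (rule bounded_imp_summable) (auto simp: g_def intro: bessel[OF f])
  then have hardy: "normalized_cauchy \<mu> f \<in> hardy_space"
    by (simp add: hardy_space_def normalized_cauchy_holomorphic f gn)
  have "hardy_inner (normalized_cauchy \<mu> f) (\<lambda>z. b z * H z) = 0" if H: "H \<in> hardy_space" for H
  proof -
    define h where "h n = fps_nth (fps_expansion H 0) n" for n
    define w where "w n = fps_nth (fps_expansion (\<lambda>z. b z * H z) 0) n" for n
    define S where "S N k = (\<Sum>n\<le>N. g n * cnj (\<tau> n k))" for N k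
    have "(\<lambda>N. \<Sum>k\<le>N. S N k * cnj (h k)) \<longlonglongrightarrow> 0"
    proof (rule weak_l2_limit)
      show "(\<lambda>N. S N k) \<longlonglongrightarrow> 0" for k
        unfolding S_def g_def by (rule clark_coeff_orthogonal[OF f])
      show "(\<Sum>k\<le>N. (norm (S N k))\<^sup>2) \<le> (\<integral>x. (norm (f x))\<^sup>2 \<partial>\<mu>)" for N
        unfolding S_def g_def by (rule order_trans[OF adjoint_contraction bessel[OF f]])
      show "summable (\<lambda>k. (norm (h k))\<^sup>2)"
        using H by (simp add: hardy_space_def h_def)
    qed
    moreover have "(\<Sum>k\<le>N. S N k * cnj (h k)) = (\<Sum>n\<le>N. g n * cnj (w n))" for N
    proof -
      have "(\<Sum>n\<le>N. g n * cnj (w n)) = (\<Sum>n\<le>N. \<Sum>k\<le>N. g n * cnj (\<tau> n k) * cnj (h k))"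
      proof (rule sum.cong[OF refl])
        fix n assume "n \<in> {..N}"
        then have "w n = (\<Sum>k\<le>N. \<tau> n k * h k)"
          using H by (simp add: w_def h_def mult_b_nth' hardy_space_def)
        then show "g n * cnj (w n) = (\<Sum>k\<le>N. g n * cnj (\<tau> n k) * cnj (h k))"
          by (simp add: sum_distrib_left mult.assoc)
      qed
      also have "\<dots> = (\<Sum>k\<le>N. S N k * cnj (h k))"
        by (subst sum.swap) (simp add: S_def sum_distrib_right)
      finally show ?thesis ..
    qed
    ultimately have "(\<lambda>n. g n * cnj (w n)) sums 0"
      by (simp add: sums_def_le)
    then show ?thesis
      by (simp add: hardy_inner_def gn w_def sums_iff)
  qed
  with hardy show ?thesis
    by (simp add: model_space_def)
qed

text \<open>Test functions z^k are enough: b z^k has column k of \<tau> as its coefficients, so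
  orthogonality to it is coordinate k of T' g = 0.\<close>

lemma model_space_orthogonal:
  assumes G: "G \<in> model_space b"
  shows "(\<lambda>N. \<Sum>n\<le>N. fps_nth (fps_expansion G 0) n * cnj (\<tau> n k)) \<longlonglongrightarrow> 0"
proof -
  define g where "g n = fps_nth (fps_expansion G 0) n" for n
  have hol: "(\<lambda>z::complex. z ^ k) holomorphic_on ball 0 1"
    by (intro holomorphic_intros)
  have "(\<lambda>z::complex. z ^ k) has_fps_expansion fps_X ^ k"
    by (intro fps_expansion_intros)
  then have nth: "fps_nth (fps_expansion (\<lambda>z. z ^ k) 0) n = (if n = k then 1 else 0)" for n
    by (simp add: fps_expansion_eqI fps_X_power_nth)
  have "(\<lambda>z. z ^ k) \<in> hardy_space"
    unfolding hardy_space_def mem_Collect_eq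
  proof (intro conjI hol)
    show "summable (\<lambda>n. (norm (fps_nth (fps_expansion (\<lambda>z. z ^ k) 0) n))\<^sup>2)"
      by (rule summable_finite[of "{k}"]) (auto simp: nth)
  qed
  then have "hardy_inner G (\<lambda>z. b z * z ^ k) = 0"
    using G by (simp add: model_space_def)
  moreover have "fps_nth (fps_expansion (\<lambda>z. b z * z ^ k) 0) n = \<tau> n k" for n
    unfolding mult_b_nth[OF hol] nth by (cases "k \<le> n") (auto simp: \<tau>_def if_distrib[of "(*) _"] cong: if_cong)
  ultimately have sum0: "(\<Sum>n. g n * cnj (\<tau> n k)) = 0"
    by (simp add: hardy_inner_def g_def)
  have "summable (\<lambda>n. g n * cnj (\<tau> n k))"
  proof (rule summable_comparison_test')
    show "summable (\<lambda>n. (norm (g n))\<^sup>2 + (norm (\<tau> n k))\<^sup>2)"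
      using G \<tau>_column_sums[of k]
      by (intro summable_add) (auto simp: model_space_def hardy_space_def g_def sums_iff)
    show "norm (g n * cnj (\<tau> n k)) \<le> (norm (g n))\<^sup>2 + (norm (\<tau> n k))\<^sup>2" for n
      using sum_squares_bound[of "norm (g n)" "norm (\<tau> n k)"]
        mult_nonneg_nonneg[OF norm_ge_zero[of "g n"] norm_ge_zero[of "\<tau> n k"]]
      unfolding mult.assoc norm_mult complex_mod_cnj by linarith
  qed
  from summable_sums[OF this] show ?thesis
    unfolding sum0 sums_def_le by (simp only: g_def)
qed

lemma sum_u_Cauchy:
  assumes g: "summable (\<lambda>n. (norm (g n))\<^sup>2)" and e: "e > 0"
  shows "\<exists>N. \<forall>m\<ge>N. \<forall>n\<ge>N. (\<integral>x. (norm ((\<Sum>i\<le>m. g i * u i x) - (\<Sum>i\<le>n. g i * u i x)))\<^sup>2 \<partial>\<mu>) \<le> e"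
proof -
  obtain N where N: "\<And>m n. m \<ge> N \<Longrightarrow> norm (\<Sum>i=m..<n. (norm (g i))\<^sup>2) < e"
    using g e unfolding summable_Cauchy by blast
  have le: "(\<integral>x. (norm ((\<Sum>i\<le>m. g i * u i x) - (\<Sum>i\<le>n. g i * u i x)))\<^sup>2 \<partial>\<mu>) \<le> e"
    if "N \<le> n" "n \<le> m" for m n
  proof -
    define a where "a i = (if n < i then g i else 0)" for i
    have "(\<Sum>i\<le>m. g i * u i x) - (\<Sum>i\<le>n. g i * u i x) = (\<Sum>i\<le>m. a i * u i x)" for x
    proof -
      have "(\<Sum>i\<le>n. g i * u i x) = (\<Sum>i\<le>m. (if n < i then 0 else g i) * u i x)"
        using that by (intro sum.mono_neutral_cong_left) auto
      then show ?thesis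
        by (simp add: a_def flip: sum_subtractf) (intro sum.cong, auto)
    qed
    then have "(\<integral>x. (norm ((\<Sum>i\<le>m. g i * u i x) - (\<Sum>i\<le>n. g i * u i x)))\<^sup>2 \<partial>\<mu>) \<le> (\<Sum>i\<le>m. (norm (a i))\<^sup>2)"
      by (simp only: norm_sum_u_le)
    also have "\<dots> = (\<Sum>i=Suc n..<Suc m. (norm (g i))\<^sup>2)"
      by (intro sum.mono_neutral_cong_right) (auto simp: a_def)
    also have "\<dots> \<le> e"
      using N[of "Suc n" "Suc m"] that by simp
    finally show ?thesis .
  qed
  show ?thesis
  proof (intro exI allI impI)
    fix m n assume "N \<le> m" "N \<le> n"
    then show "(\<integral>x. (norm ((\<Sum>i\<le>m. g i * u i x) - (\<Sum>i\<le>n. g i * u i x)))\<^sup>2 \<partial>\<mu>) \<le> e"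
      using le[of n m] le[of m n] by (cases "n \<le> m") (simp_all add: norm_minus_commute)
  qed
qed

text \<open>The preimage is the sum of the \<open>g n * u n x\<close>, with g the Taylor
  coefficients of G. By \<open>gram_u\<close> it has the coefficients g - T T' g, and T' g = 0 on
  the model space.\<close>

theorem normalized_cauchy_surjective:
  assumes G: "G \<in> model_space b"
  obtains f where "f \<in> L2 \<mu>" "\<And>z. z \<in> ball 0 1 \<Longrightarrow> normalized_cauchy \<mu> f z = G z"
proof -
  define g where "g n = fps_nth (fps_expansion G 0) n" for n
  define s where "s N x = (\<Sum>n\<le>N. g n * u n x)" for N x
  define S where "S N k = (\<Sum>n\<le>N. g n * cnj (\<tau> n k))" for N k
  have hol: "G holomorphic_on ball 0 1" and sm: "summable (\<lambda>n. (norm (g n))\<^sup>2)"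
    using G by (auto simp: model_space_def hardy_space_def g_def)
  have s_L2: "s N \<in> L2 \<mu>" for N
    unfolding s_def[abs_def] by (rule sum_u_L2)
  obtain f where f: "f \<in> L2 \<mu>" and lim: "(\<lambda>n. \<integral>x. (norm (f x - s n x))\<^sup>2 \<partial>\<mu>) \<longlonglongrightarrow> 0"
  proof (rule L2_complete[of \<mu> s])
    show "finite_measure \<mu>"
      by (rule finite_measure_axioms)
    show "\<exists>N. \<forall>m\<ge>N. \<forall>n\<ge>N. (\<integral>x. (norm (s m x - s n x))\<^sup>2 \<partial>\<mu>) \<le> e" if "e > 0" for e
      unfolding s_def by (rule sum_u_Cauchy[OF sm that])
  qed (use s_L2 in auto)
  have coeff: "clark_coeff f m = g m" for m
  proof (rule LIMSEQ_unique)
    show "(\<lambda>N. clark_coeff (s N) m) \<longlonglongrightarrow> clark_coeff f m"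
    proof -
      define U where "U = (\<integral>x. (norm (u m x))\<^sup>2 \<partial>\<mu>)"
      have bd: "(norm (clark_coeff f m - clark_coeff (s N) m))\<^sup>2 \<le> (\<integral>x. (norm (f x - s N x))\<^sup>2 \<partial>\<mu>) * U" for N
      proof -
        have "clark_coeff f m - clark_coeff (s N) m = (\<integral>x. (f x - s N x) * cnj (u m x) \<partial>\<mu>)"
          using L2_integrable_mult[OF f L2_cnj[OF u_L2]] L2_integrable_mult[OF s_L2 L2_cnj[OF u_L2]]
          by (simp add: clark_coeff_def left_diff_distrib)
        then show ?thesis
          using L2_Cauchy_Schwarz[OF L2_diff[OF f s_L2[of N]] L2_cnj[OF u_L2[of m]]]
          by (simp only: complex_mod_cnj U_def)
      qed
      have "(\<lambda>N. (norm (clark_coeff f m - clark_coeff (s N) m))\<^sup>2) \<longlonglongrightarrow> 0"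
        by (rule Lim_null_comparison[OF always_eventually tendsto_mult_left_zero[OF lim, of U]])
          (use bd in simp)
      then have "(\<lambda>N. sqrt ((norm (clark_coeff f m - clark_coeff (s N) m))\<^sup>2)) \<longlonglongrightarrow> sqrt 0"
        by (rule tendsto_real_sqrt)
      then have "(\<lambda>N. clark_coeff f m - clark_coeff (s N) m) \<longlonglongrightarrow> 0"
        by (simp add: tendsto_norm_zero_iff)
      from tendsto_diff[OF tendsto_const[of "clark_coeff f m"] this] show ?thesis
        by simp
    qed
    \<comment> \<open>Row m of T has only the entries j \<le> m, a number independent of N; so
      coordinatewise convergence of \<open>S N\<close> to 0 is enough.\<close>
    have eq: "clark_coeff (s N) m = g m - (\<Sum>j\<le>m. \<tau> m j * S N j)" if N: "N \<ge> m" for N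
    proof -
      have "clark_coeff (s N) m = (\<integral>x. (\<Sum>n\<le>N. g n * (u n x * cnj (u m x))) \<partial>\<mu>)"
        by (simp add: clark_coeff_def s_def sum_distrib_right mult.assoc)
      also have "\<dots> = (\<Sum>n\<le>N. g n * (\<integral>x. u n x * cnj (u m x) \<partial>\<mu>))"
        using L2_integrable_mult[OF u_L2 L2_cnj[OF u_L2]] by simp
      also have "\<dots> = (\<Sum>n\<le>N. g n * ((if n = m then 1 else 0) - (\<Sum>j\<le>N. cnj (\<tau> n j) * \<tau> m j)))"
        using N by (intro sum.cong refl) (simp add: gram_u[of _ N])
      also have "\<dots> = (\<Sum>n\<le>N. g n * (if n = m then 1 else 0)) - (\<Sum>n\<le>N. \<Sum>j\<le>N. \<tau> m j * (g n * cnj (\<tau> n j)))"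
        by (simp only: right_diff_distrib sum_subtractf sum_distrib_left) (simp only: ac_simps)
      also have "(\<Sum>n\<le>N. g n * (if n = m then 1 else 0)) = g m"
        using N by (subst sum.remove[of _ m]) (auto intro!: sum.neutral)
      also have "(\<Sum>n\<le>N. \<Sum>j\<le>N. \<tau> m j * (g n * cnj (\<tau> n j))) = (\<Sum>j\<le>N. \<tau> m j * S N j)"
        by (subst sum.swap) (simp add: S_def sum_distrib_left)
      also have "\<dots> = (\<Sum>j\<le>m. \<tau> m j * S N j)"
        using N by (intro sum.mono_neutral_right) (auto simp: \<tau>_def)
      finally show ?thesis .
    qed
    have "(\<lambda>N. g m - (\<Sum>j\<le>m. \<tau> m j * S N j)) \<longlonglongrightarrow> g m - (\<Sum>j\<le>m. \<tau> m j * 0)"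
      using model_space_orthogonal[OF G] by (intro tendsto_intros) (simp add: S_def g_def)
    then have "(\<lambda>N. g m - (\<Sum>j\<le>m. \<tau> m j * S N j)) \<longlonglongrightarrow> g m"
      by simp
    then show "(\<lambda>N. clark_coeff (s N) m) \<longlonglongrightarrow> g m"
    proof (rule Lim_transform_eventually)
      show "\<forall>\<^sub>F N in sequentially. g m - (\<Sum>j\<le>m. \<tau> m j * S N j) = clark_coeff (s N) m"
        using eventually_ge_at_top[of m] by eventually_elim (simp add: eq)
    qed
  qed
  have "fps_expansion (normalized_cauchy \<mu> f) 0 = fps_expansion G 0"
    by (simp add: fps_eq_iff normalized_cauchy_nth[OF f] coeff g_def)
  then have "normalized_cauchy \<mu> f z = G z" if "z \<in> ball 0 1" for z
    using holomorphic_fps_expansion_unique[OF normalized_cauchy_holomorphic[OF f] hol _ that] by blast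
  with f that show ?thesis
    by blast
qed

end

section \<open>Clark's theorem: injectivity\<close>

context clark
begin

text \<open>The character \<open>fourier_char (- 1)\<close> has coefficients \<open>\<beta> (Suc n)\<close>; by \<open>\<beta>_sums\<close> these have norm \<open>1\<close>, so
  that it is the limit of the corresponding combinations of the \<open>u n\<close>.\<close>

lemma fourier_coeff_minus_1_eq_0:
  assumes f: "f \<in> L2 \<mu>" and zero: "\<And>n. fourier_coeff f (int n) = 0"
  shows "fourier_coeff f (- 1) = 0"
proof -
  define e where "e = fourier_char (- 1)"
  have e: "e \<in> L2 \<mu>"
    unfolding e_def by (rule fourier_char_L2)
  define P where "P N x = (\<Sum>n\<le>N. \<beta> (Suc n) * u n x)" for N x
  define s where "s N = (\<Sum>n\<le>N. (norm (\<beta> (Suc n)))\<^sup>2)" for N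
  have P: "P N \<in> L2 \<mu>" for N
    unfolding P_def[abs_def] by (rule sum_u_L2)
  \<comment> \<open>The character shifts the Fourier coefficients of the measure by one, so the sum
    is the convolution of index Suc n without its term at \<open>c 0\<close>.\<close>
  have ec: "clark_coeff e n = \<beta> (Suc n)" for n
  proof -
    have "fourier_coeff e (int j) = c (int (Suc j))" for j
      by (simp add: fourier_coeff_def e_def flip: fourier_char_add)
    then have "clark_coeff e n = (\<Sum>j\<le>n. \<alpha> (n - j) * c (int (Suc j)))"
      by (simp add: clark_coeff_eq e)
    also have "\<dots> = - \<alpha> (Suc n)"
      using \<alpha>_convolution[of "Suc n"] unfolding sum.atMost_Suc_shift
      by (simp add: fourier_coeff_1_0 add_eq_0_iff)
    finally show ?thesis
      by (simp add: \<alpha>_def)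
  qed
  \<comment> \<open>Expanding the square: e has norm 1, the cross term is - 2 s N, and the squared
    norm of P N is at most s N.\<close>
  have dist: "(\<integral>x. (norm (e x - P N x))\<^sup>2 \<partial>\<mu>) \<le> 1 - s N" for N
  proof -
    have "(\<integral>x. e x * cnj (P N x) \<partial>\<mu>) = (\<Sum>n\<le>N. \<beta> (Suc n) * cnj (\<beta> (Suc n)))"
      unfolding P_def by (simp only: integral_mult_cnj_sum_u[OF e] ec)
    also have "\<dots> = of_real (s N)"
      by (simp only: s_def of_real_sum complex_norm_square)
    finally have "Re (\<integral>x. e x * cnj (P N x) \<partial>\<mu>) = s N"
      by simp
    moreover have "(\<integral>x. (norm (e x))\<^sup>2 \<partial>\<mu>) = 1"
      by (simp add: e_def prob_space)
    moreover have "(\<integral>x. (norm (P N x))\<^sup>2 \<partial>\<mu>) \<le> s N"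
      unfolding P_def s_def by (rule norm_sum_u_le)
    ultimately show ?thesis
      unfolding L2_norm_diff[OF e P] by linarith
  qed
  define A where "A = (\<integral>x. (norm (f x))\<^sup>2 \<partial>\<mu>)"
  have "(norm (fourier_coeff f (- 1)))\<^sup>2 \<le> A * (1 - s N)" for N
  proof -
    have "(\<integral>x. f x * cnj (P N x) \<partial>\<mu>) = 0"
      unfolding P_def by (simp add: integral_mult_cnj_sum_u[OF f, simplified] clark_coeff_eq f zero)
    moreover have "(\<integral>x. f x * cnj (e x - P N x) \<partial>\<mu>)
        = (\<integral>x. f x * cnj (e x) \<partial>\<mu>) - (\<integral>x. f x * cnj (P N x) \<partial>\<mu>)"
      using L2_integrable_mult[OF f L2_cnj[OF e]] L2_integrable_mult[OF f L2_cnj[OF P]]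
      by (simp add: right_diff_distrib)
    ultimately have "fourier_coeff f (- 1) = (\<integral>x. f x * cnj (e x - P N x) \<partial>\<mu>)"
      by (simp add: fourier_coeff_def e_def)
    then have "(norm (fourier_coeff f (- 1)))\<^sup>2 \<le> A * (\<integral>x. (norm (e x - P N x))\<^sup>2 \<partial>\<mu>)"
      using L2_Cauchy_Schwarz[OF f L2_cnj[OF L2_diff[OF e P[of N]]]] by (simp only: complex_mod_cnj A_def)
    also have "\<dots> \<le> A * (1 - s N)"
      by (intro mult_left_mono dist) (simp add: A_def)
    finally show ?thesis .
  qed
  moreover have "(\<lambda>N. A * (1 - s N)) \<longlonglongrightarrow> 0"
  proof -
    \<comment> \<open>Dropping the index 0 loses no mass, because b vanishes at 0.\<close>
    have "(\<lambda>n. (norm (\<beta> (Suc n)))\<^sup>2) sums 1"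
      using \<beta>_sums by (subst sums_Suc_iff) (simp add: \<beta>_0)
    then have "s \<longlonglongrightarrow> 1"
      by (simp add: s_def[abs_def] sums_def_le)
    then have "(\<lambda>N. A * (1 - s N)) \<longlonglongrightarrow> A * (1 - 1)"
      by (intro tendsto_intros)
    then show ?thesis
      by simp
  qed
  ultimately have "(norm (fourier_coeff f (- 1)))\<^sup>2 \<le> 0"
    by (intro LIMSEQ_le_const) auto
  then show ?thesis
    by simp
qed

lemma fourier_coeff_shift: "fourier_coeff (\<lambda>x. f x * fourier_char m x) n = fourier_coeff f (n - m)"
proof -
  have "fourier_char m x * fourier_char (- n) x = fourier_char (- (n - m)) x" for x
    by (simp flip: fourier_char_add)
  then show ?thesis
    by (simp add: fourier_coeff_def mult.assoc)
qed

text \<open>Multiplication by \<open>fourier_char (int m)\<close> shifts the coefficients, so the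
  argument for the index -1 applies to each negative index in turn.\<close>

lemma fourier_coeff_eq_0:
  assumes f: "f \<in> L2 \<mu>" and zero: "\<And>n. fourier_coeff f (int n) = 0"
  shows "fourier_coeff f k = 0"
proof -
  have "\<forall>n\<ge>- int m. fourier_coeff f n = 0" for m
  proof (induction m)
    case 0
    show ?case
      using zero by (auto dest: zero_le_imp_eq_int)
  next
    case (Suc m)
    define g where "g x = f x * fourier_char (int m) x" for x
    have g: "g \<in> L2 \<mu>"
    proof -
      have [measurable]: "f \<in> borel_measurable \<mu>"
        using f by (simp add: L2_def)
      show ?thesis
        using f by (simp add: L2_def g_def[abs_def] norm_mult)
    qed
    have gc: "fourier_coeff g n = fourier_coeff f (n - int m)" for n
      unfolding g_def by (rule fourier_coeff_shift)
    have "fourier_coeff g (- 1) = 0"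
      by (rule fourier_coeff_minus_1_eq_0[OF g]) (use Suc in \<open>simp add: gc\<close>)
    then have "fourier_coeff f (- int (Suc m)) = 0"
      by (simp add: gc algebra_simps)
    with Suc show ?case
      by (metis (no_types, lifting) add.commute int_ops(4) le_less minus_add_distrib not_le
          of_nat_Suc uminus_add_conv_diff zle_diff1_eq)
  qed
  from this[of "nat (- k)"] show ?thesis
    by (cases "k \<ge> 0") auto
qed

end

section \<open>Fourier transforms on the complex plane, and uniqueness\<close>

context circle_probability
begin

definition fourier_transform :: "(real \<Rightarrow> complex) \<Rightarrow> complex \<Rightarrow> complex" where
  "fourier_transform f z = (\<integral>x. f x * exp (- 2 * of_real pi * \<i> * of_real x * z) \<partial>\<mu>)"

lemma abs_le_half: "x \<in> space \<mu> \<Longrightarrow> \<bar>x\<bar> < 1 / 2"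
  by (auto simp: space_eq)

lemma continuous_L2:
  fixes \<phi> :: "real \<Rightarrow> complex"
  assumes "continuous_on UNIV \<phi>"
  shows "\<phi> \<in> L2 \<mu>"
proof -
  have "compact (\<phi> ` {-1/2..1/2})"
    by (intro compact_continuous_image continuous_on_subset[OF assms]) auto
  from compact_imp_bounded[OF this] obtain B where B: "\<forall>y\<in>\<phi> ` {-1/2..1/2}. norm y \<le> B"
    unfolding bounded_iff by blast
  have "norm (\<phi> x) \<le> B" if "x \<in> space \<mu>" for x
    using that by (intro bspec[OF B] imageI) (simp add: space_eq)
  moreover have "\<phi> \<in> borel_measurable \<mu>"
    by (intro borel_measurable_circle borel_measurable_continuous_onI assms)
  ultimately show ?thesis
    by (intro L2_bounded finite_measure_axioms)
qed

lemma power_L2: "(\<lambda>x. of_real x ^ n) \<in> L2 \<mu>"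
  by (intro continuous_L2 continuous_intros)

definition moment :: "(real \<Rightarrow> complex) \<Rightarrow> nat \<Rightarrow> complex" where
  "moment f n = (\<integral>x. f x * of_real x ^ n \<partial>\<mu>)"

lemma fourier_transform_sums:
  assumes f: "f \<in> L2 \<mu>"
  shows "(\<lambda>n. ((- 2 * of_real pi * \<i>) ^ n / fact n * moment f n) * z ^ n) sums fourier_transform f z"
proof -
  define w where "w = - 2 * of_real pi * \<i> * z"
  define t where "t n x = (w ^ n / fact n) * (f x * of_real x ^ n)" for n x
  have int: "integrable \<mu> (\<lambda>x. f x * of_real x ^ n)" for n
    by (intro L2_integrable_mult f power_L2)
  have nt: "norm (t n x) = norm w ^ n / fact n * (norm (f x) * \<bar>x\<bar> ^ n)" for n x
    by (simp add: t_def norm_mult norm_divide norm_power)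
  have ts: "(\<lambda>n. t n x) sums (f x * exp (of_real x * w))" for x
    using sums_mult[OF exp_converges[of "of_real x * w"], of "f x"]
    by (simp add: t_def power_mult_distrib scaleR_conv_of_real field_simps)
  have "(\<lambda>n. integral\<^sup>L \<mu> (t n)) sums (\<integral>x. (\<Sum>n. t n x) \<partial>\<mu>)"
  proof (rule sums_integral)
    show "integrable \<mu> (t n)" for n
      unfolding t_def[abs_def] by (intro integrable_mult_right int)
    show "AE x in \<mu>. summable (\<lambda>n. norm (t n x))"
    proof (rule AE_I2)
      fix x
      have "summable (\<lambda>n. norm (f x) * (norm ((of_real x * w) ^ n /\<^sub>R fact n)))"
        by (intro summable_mult summable_norm_exp)
      then show "summable (\<lambda>n. norm (t n x))"
        by (simp add: nt norm_mult norm_power power_mult_distrib divide_inverse ac_simps)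
    qed
    show "summable (\<lambda>n. \<integral>x. norm (t n x) \<partial>\<mu>)"
    proof (rule summable_comparison_test')
      show "summable (\<lambda>n. (norm w ^ n /\<^sub>R fact n) * (\<integral>x. norm (f x) \<partial>\<mu>))"
        by (intro summable_mult2 summable_exp_generic)
      fix n :: nat
      have "(\<integral>x. norm (t n x) \<partial>\<mu>) \<le> (\<integral>x. (norm w ^ n / fact n) * norm (f x) \<partial>\<mu>)"
      proof (rule integral_mono)
        show "integrable \<mu> (\<lambda>x. norm (t n x))"
          unfolding t_def by (intro integrable_norm integrable_mult_right int)
        show "integrable \<mu> (\<lambda>x. norm w ^ n / fact n * norm (f x))"
          by (intro integrable_mult_right integrable_norm L2_integrable finite_measure_axioms f)
        show "norm (t n x) \<le> norm w ^ n / fact n * norm (f x)" if "x \<in> space \<mu>" for x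
          unfolding nt using abs_le_half[OF that]
          by (intro mult_left_mono mult_left_le power_le_one) auto
      qed
      then show "norm (\<integral>x. norm (t n x) \<partial>\<mu>) \<le> (norm w ^ n /\<^sub>R fact n) * (\<integral>x. norm (f x) \<partial>\<mu>)"
        by (simp add: divide_inverse mult.commute)
    qed
  qed
  moreover have "(\<Sum>n. t n x) = f x * exp (- 2 * of_real pi * \<i> * of_real x * z)" for x
    using ts[of x] by (simp add: sums_iff w_def ac_simps)
  moreover have "integral\<^sup>L \<mu> (t n) = ((- 2 * of_real pi * \<i>) ^ n / fact n * moment f n) * z ^ n" for n
    unfolding t_def[abs_def] integral_mult_right_zero moment_def[symmetric]
    by (simp only: w_def power_mult_distrib times_divide_eq_left times_divide_eq_right ac_simps)
  ultimately show ?thesis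
    by (simp add: fourier_transform_def)
qed

lemma fourier_transform_holomorphic:
  assumes f: "f \<in> L2 \<mu>"
  shows "fourier_transform f holomorphic_on UNIV"
proof -
  have "fourier_transform f holomorphic_on ball 0 r" for r
    by (rule power_series_holomorphic) (unfold diff_zero, rule fourier_transform_sums[OF f])
  then have "fourier_transform f holomorphic_on (\<Union>r. ball 0 r)"
    by (intro holomorphic_on_UN_open) auto
  moreover have "(\<Union>r. ball (0::complex) r) = UNIV"
    using gt_ex by (fastforce simp: dist_norm)
  ultimately show ?thesis
    by simp
qed

lemma fourier_transform_of_int: "fourier_transform f (of_int n) = fourier_coeff f n"
proof -
  have "exp (- 2 * of_real pi * \<i> * of_real x * of_int n) = fourier_char (- n) x" for x
    by (simp add: fourier_char_def cis_conv_exp ac_simps)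
  then show ?thesis
    by (simp add: fourier_transform_def fourier_coeff_def)
qed

text \<open>|exp(- 2 pi i x z)| \<le> exp(2 pi |x| |z|), which is exp(pi |z|) times exp(- 2 pi (1/2
  - |x|) |z|). As |x| < 1/2, the last factor tends to 0 for each x, and its integral against |f|
  does so by dominated convergence; this integral is \<epsilon>.\<close>

lemma fourier_transform_bound:
  assumes f: "f \<in> L2 \<mu>"
  obtains \<epsilon> :: "real \<Rightarrow> real" where "\<And>r. r \<ge> 0 \<Longrightarrow> 0 \<le> \<epsilon> r" "(\<epsilon> \<longlongrightarrow> 0) at_top"
    "\<And>z. norm (fourier_transform f z) \<le> \<epsilon> (norm z) * exp (pi * norm z)"
proof -
  have [measurable]: "f \<in> borel_measurable \<mu>"
    using f by (simp add: L2_def)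
  have [measurable]: "(\<lambda>x. x) \<in> borel_measurable \<mu>"
    by (rule borel_measurable_circle) simp
  have fi: "integrable \<mu> (\<lambda>x. norm (f x))"
    by (intro integrable_norm L2_integrable finite_measure_axioms f)
  define \<phi> where "\<phi> r x = norm (f x) * exp (- (2 * pi * (1 / 2 - \<bar>x\<bar>) * r))" for r x
  have \<phi>_meas: "\<phi> r \<in> borel_measurable \<mu>" for r
    unfolding \<phi>_def by measurable
  define \<epsilon> where "\<epsilon> r = integral\<^sup>L \<mu> (\<phi> r)" for r
  have \<phi>_le: "\<phi> r x \<le> norm (f x)" if "x \<in> space \<mu>" "r \<ge> 0" for r x
    using abs_le_half[OF that(1)] that(2) by (auto simp: \<phi>_def intro!: mult_left_le mult_nonneg_nonneg)
  have \<phi>_int: "integrable \<mu> (\<phi> r)" if "r \<ge> 0" for r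
  proof (rule Bochner_Integration.integrable_bound[OF fi])
    show "\<phi> r \<in> borel_measurable \<mu>"
      by (rule \<phi>_meas)
    show "AE x in \<mu>. norm (\<phi> r x) \<le> norm (norm (f x))"
      using \<phi>_le that by (intro AE_I2) (simp add: \<phi>_def)
  qed
  show ?thesis
  proof
    show "0 \<le> \<epsilon> r" for r
      unfolding \<epsilon>_def by (rule integral_nonneg_AE) (simp add: \<phi>_def)
    have "((\<lambda>r. integral\<^sup>L \<mu> (\<phi> r)) \<longlongrightarrow> (\<integral>x. 0 \<partial>\<mu>)) at_top"
    proof (rule integral_dominated_convergence_at_top[where w = "\<lambda>x. norm (f x)"])
      show "AE x in \<mu>. ((\<lambda>r. \<phi> r x) \<longlongrightarrow> 0) at_top"
      proof (rule AE_I2)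
        fix x assume "x \<in> space \<mu>"
        then have "2 * pi * (1 / 2 - \<bar>x\<bar>) > 0"
          using abs_le_half by simp
        then have "((\<lambda>r. exp (- (2 * pi * (1 / 2 - \<bar>x\<bar>) * r))) \<longlongrightarrow> 0) at_top"
          by (intro filterlim_compose[OF exp_at_bot])
            (simp add: filterlim_uminus_at_top[symmetric] filterlim_tendsto_pos_mult_at_top[OF tendsto_const _ filterlim_ident])
        then show "((\<lambda>r. \<phi> r x) \<longlongrightarrow> 0) at_top"
          unfolding \<phi>_def by (rule tendsto_mult_right_zero)
      qed
      show "\<forall>\<^sub>F r in at_top. AE x in \<mu>. norm (\<phi> r x) \<le> norm (f x)"
        using eventually_ge_at_top[of 0]
      proof eventually_elim
        case (elim r)
        with \<phi>_le show ?case
          by (intro AE_I2) (simp add: \<phi>_def)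
      qed
    qed (use fi \<phi>_meas in auto)
    then show "(\<epsilon> \<longlongrightarrow> 0) at_top"
      by (simp add: \<epsilon>_def[abs_def])
    show "norm (fourier_transform f z) \<le> \<epsilon> (norm z) * exp (pi * norm z)" for z
    proof -
      have "norm (fourier_transform f z) \<le> (\<integral>x. norm (f x * exp (- 2 * of_real pi * \<i> * of_real x * z)) \<partial>\<mu>)"
        unfolding fourier_transform_def by (rule integral_norm_bound)
      also have "\<dots> \<le> (\<integral>x. \<phi> (norm z) x * exp (pi * norm z) \<partial>\<mu>)"
      proof (rule integral_mono)
        show "integrable \<mu> (\<lambda>x. norm (f x * exp (- 2 * of_real pi * \<i> * of_real x * z)))"
          by (intro integrable_norm L2_integrable_mult f continuous_L2 continuous_intros)
        show "integrable \<mu> (\<lambda>x. \<phi> (norm z) x * exp (pi * norm z))"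
          by (intro integrable_mult_left \<phi>_int) simp
        fix x assume "x \<in> space \<mu>"
        have "x * Im z \<le> \<bar>x\<bar> * norm z"
          using mult_mono[OF order_refl abs_Im_le_cmod[of z], of "\<bar>x\<bar>"] abs_ge_self[of "x * Im z"]
          by (simp add: abs_mult)
        then have "2 * pi * (x * Im z) \<le> 2 * pi * (\<bar>x\<bar> * norm z)"
          by (intro mult_left_mono) auto
        then show "norm (f x * exp (- 2 * of_real pi * \<i> * of_real x * z)) \<le> \<phi> (norm z) x * exp (pi * norm z)"
          by (auto simp: \<phi>_def norm_mult mult.assoc algebra_simps exp_add[symmetric] intro!: mult_left_mono)
      qed
      also have "\<dots> = \<epsilon> (norm z) * exp (pi * norm z)"
        by (simp add: \<epsilon>_def)
      finally show ?thesis .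
    qed
  qed
qed

text \<open>By \<open>carlson\<close> the transform vanishes identically, and its Taylor
  coefficients are nonzero multiples of the moments. This trades characters for powers of x, to
  which Weierstrass approximation on the closed interval applies.\<close>

lemma moment_eq_0:
  assumes f: "f \<in> L2 \<mu>" and zero: "\<And>n. fourier_coeff f n = 0"
  shows "moment f n = 0"
proof -
  obtain \<epsilon> where \<epsilon>: "(\<epsilon> \<longlongrightarrow> 0) at_top" "\<And>z. norm (fourier_transform f z) \<le> \<epsilon> (norm z) * exp (pi * norm z)"
    using fourier_transform_bound[OF f] by metis
  have T0: "fourier_transform f z = 0" for z
    by (rule carlson[OF fourier_transform_holomorphic[OF f] _ \<epsilon>]) (simp add: fourier_transform_of_int zero)
  define a where "a n = (- 2 * of_real pi * \<i>) ^ n / fact n * moment f n" for n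
  have "(\<lambda>z. 0) has_fps_expansion Abs_fps a"
    using fourier_transform_sums[OF f] by (intro has_fps_expansionI) (simp add: T0 a_def)
  then have "Abs_fps a = 0"
    using fps_expansion_unique_complex has_fps_expansion_0 by blast
  then have "a n = 0"
    by (metis fps_nth_Abs_fps fps_zero_nth)
  then show ?thesis
    by (simp add: a_def)
qed

lemma integral_continuous_eq_0:
  assumes f: "f \<in> L2 \<mu>" and zero: "\<And>n. moment f n = 0"
    and \<phi>: "continuous_on UNIV \<phi>"
  shows "(\<integral>x. f x * complex_of_real (\<phi> x) \<partial>\<mu>) = 0"
proof -
  have cont: "(\<lambda>x. complex_of_real (\<psi> x)) \<in> L2 \<mu>" if "continuous_on UNIV \<psi>" for \<psi>
    using that by (intro continuous_L2 continuous_intros)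
  define A where "A = (\<integral>x. norm (f x) \<partial>\<mu>)"
  have fi: "integrable \<mu> (\<lambda>x. norm (f x))"
    by (intro integrable_norm L2_integrable finite_measure_axioms f)
  have "norm (\<integral>x. f x * complex_of_real (\<phi> x) \<partial>\<mu>) \<le> e * A" if e: "e > 0" for e
  proof -
    obtain p where p: "real_polynomial_function p" "\<And>x. x \<in> {-1/2..1/2} \<Longrightarrow> \<bar>\<phi> x - p x\<bar> < e"
      using Stone_Weierstrass_real_polynomial_function[OF compact_Icc continuous_on_subset[OF \<phi>] e] by blast
    obtain a n where pa: "p = (\<lambda>x. \<Sum>i\<le>n. a i * x ^ i)"
      using p(1) real_polynomial_function_iff_sum by blast
    have pc: "continuous_on UNIV p"
      unfolding pa by (intro continuous_intros)
    have "(\<integral>x. f x * complex_of_real (p x) \<partial>\<mu>) = (\<integral>x. (\<Sum>i\<le>n. of_real (a i) * (f x * of_real x ^ i)) \<partial>\<mu>)"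
      by (simp add: pa sum_distrib_left ac_simps)
    also have "\<dots> = (\<Sum>i\<le>n. of_real (a i) * moment f i)"
      using L2_integrable_mult[OF f power_L2] by (simp add: moment_def)
    finally have "(\<integral>x. f x * complex_of_real (p x) \<partial>\<mu>) = 0"
      by (simp add: zero)
    then have "(\<integral>x. f x * complex_of_real (\<phi> x) \<partial>\<mu>) = (\<integral>x. f x * complex_of_real (\<phi> x) - f x * complex_of_real (p x) \<partial>\<mu>)"
      using L2_integrable_mult[OF f cont[OF \<phi>]] L2_integrable_mult[OF f cont[OF pc]] by simp
    also have "norm \<dots> \<le> (\<integral>x. norm (f x * complex_of_real (\<phi> x) - f x * complex_of_real (p x)) \<partial>\<mu>)"
      by (rule integral_norm_bound)
    also have "\<dots> \<le> (\<integral>x. e * norm (f x) \<partial>\<mu>)"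
    proof (rule integral_mono)
      show "integrable \<mu> (\<lambda>x. norm (f x * complex_of_real (\<phi> x) - f x * complex_of_real (p x)))"
        by (intro integrable_norm Bochner_Integration.integrable_diff L2_integrable_mult f cont \<phi> pc)
      show "integrable \<mu> (\<lambda>x. e * norm (f x))"
        using fi by simp
      fix x assume "x \<in> space \<mu>"
      then have "\<bar>\<phi> x - p x\<bar> \<le> e"
        using p(2)[of x] by (auto simp: space_eq)
      moreover have "norm (f x * complex_of_real (\<phi> x) - f x * complex_of_real (p x)) = norm (f x) * \<bar>\<phi> x - p x\<bar>"
        by (simp flip: right_diff_distrib of_real_diff add: norm_mult)
      ultimately show "norm (f x * complex_of_real (\<phi> x) - f x * complex_of_real (p x)) \<le> e * norm (f x)"
        by (simp add: mult.commute[of e] mult_left_mono)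
    qed
    also have "\<dots> = e * A"
      by (simp add: A_def)
    finally show ?thesis .
  qed
  then have "norm (\<integral>x. f x * complex_of_real (\<phi> x) \<partial>\<mu>) \<le> 0"
  proof (intro tendsto_lowerbound[where F = "at_right 0"])
    show "((\<lambda>e. e * A) \<longlongrightarrow> 0) (at_right 0)"
      by (auto intro!: tendsto_eq_intros)
    show "\<forall>\<^sub>F e in at_right 0. norm (\<integral>x. f x * complex_of_real (\<phi> x) \<partial>\<mu>) \<le> e * A"
      if "\<And>e. e > 0 \<Longrightarrow> norm (\<integral>x. f x * complex_of_real (\<phi> x) \<partial>\<mu>) \<le> e * A"
      using eventually_at_right_less by eventually_elim (rule that)
  qed auto
  then show ?thesis
    by simp
qed

text \<open>Continuous ramps approximate the indicators of half-lines, and half-lines generate the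
  Borel sets; so all set integrals of f vanish.\<close>

lemma AE_eq_0_of_moments:
  assumes f: "f \<in> L2 \<mu>" and zero: "\<And>n. moment f n = 0"
  shows "AE x in \<mu>. f x = 0"
proof (rule density_zero)
  have [measurable]: "f \<in> borel_measurable \<mu>"
    using f by (simp add: L2_def)
  show fi: "integrable \<mu> f"
    by (intro L2_integrable finite_measure_axioms f)
  \<comment> \<open>Intersecting with the space lets the induction run over the Borel sets of the
    whole line, which the half-lines generate.\<close>
  define J where "J A = (LINT x:A \<inter> space \<mu>|\<mu>. f x)" for A
  have sets: "A \<inter> space \<mu> \<in> sets \<mu>" if "A \<in> sets borel" for A
    using that unfolding sets_eq circle_borel_def space_eq by (auto simp: sets_restrict_space)
  have si: "set_integrable \<mu> (A \<inter> space \<mu>) f" if "A \<in> sets borel" for A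
    unfolding set_integrable_def by (intro integrable_mult_indicator sets that fi)
  have J_atMost: "J {..a} = 0" for a
  proof -
    \<comment> \<open>For k > 0 this is 1 up to a and then falls linearly to 0 over a length 1 /
      k.\<close>
    define \<phi> where "\<phi> k x = max 0 (min 1 (1 - real k * (x - a)))" for k :: nat and x
    have "(\<lambda>k. \<integral>x. f x * complex_of_real (\<phi> k x) \<partial>\<mu>) \<longlonglongrightarrow> (\<integral>x. indicator ({..a} \<inter> space \<mu>) x *\<^sub>R f x \<partial>\<mu>)"
    proof (rule integral_dominated_convergence[where w = "\<lambda>x. norm (f x)"])
      show "AE x in \<mu>. (\<lambda>k. f x * complex_of_real (\<phi> k x)) \<longlonglongrightarrow> indicator ({..a} \<inter> space \<mu>) x *\<^sub>R f x"
      proof (rule AE_I2)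
        fix x assume x: "x \<in> space \<mu>"
        show "(\<lambda>k. f x * complex_of_real (\<phi> k x)) \<longlonglongrightarrow> indicator ({..a} \<inter> space \<mu>) x *\<^sub>R f x"
        proof (cases "x \<le> a")
          case True
          then have "\<phi> k x = 1" for k
            by (simp add: \<phi>_def mult_nonneg_nonpos)
          then show ?thesis
            using True x by simp
        next
          case False
          obtain K :: nat where K: "real K * (x - a) > 1"
            using reals_Archimedean3[of "x - a"] False by auto
          have "\<phi> k x = 0" if "k \<ge> K" for k
          proof -
            have "real K * (x - a) \<le> real k * (x - a)"
              using that False by (intro mult_right_mono) auto
            then show ?thesis
              using K by (simp add: \<phi>_def)
          qed
          have "\<forall>\<^sub>F k in sequentially. f x * complex_of_real (\<phi> k x) = 0"
            using eventually_ge_at_top[of K] by eventually_elim (simp add: \<open>\<And>k. k \<ge> K \<Longrightarrow> \<phi> k x = 0\<close>)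
          then have "(\<lambda>k. f x * complex_of_real (\<phi> k x)) \<longlonglongrightarrow> 0"
            by (rule tendsto_eventually)
          then show ?thesis
            using False by simp
        qed
      qed
      have "continuous_on UNIV (\<lambda>x. complex_of_real (\<phi> k x))" for k
        unfolding \<phi>_def by (intro continuous_intros)
      then have "(\<lambda>x. complex_of_real (\<phi> k x)) \<in> borel_measurable \<mu>" for k
        by (intro borel_measurable_circle borel_measurable_continuous_onI)
      then show "(\<lambda>x. f x * complex_of_real (\<phi> k x)) \<in> borel_measurable \<mu>" for k
        by measurable
      show "(\<lambda>x. indicator ({..a} \<inter> space \<mu>) x *\<^sub>R f x) \<in> borel_measurable \<mu>"
        using sets[of "{..a}"] by measurable
      show "AE x in \<mu>. norm (f x * complex_of_real (\<phi> k x)) \<le> norm (f x)" for k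
        by (intro AE_I2) (auto simp: norm_mult \<phi>_def intro!: mult_left_le)
    qed (use fi in simp)
    moreover have "(\<integral>x. f x * complex_of_real (\<phi> k x) \<partial>\<mu>) = 0" for k
      unfolding \<phi>_def by (intro integral_continuous_eq_0 f zero continuous_intros)
    ultimately show ?thesis
      by (simp add: J_def set_lebesgue_integral_def LIMSEQ_const_iff)
  qed
  have J: "J A = 0" if "A \<in> sets borel" for A
  proof -
    have "Int_stable (range (\<lambda>a::real. {..a}))"
      by (auto simp: Int_stable_def)
    moreover have "range (\<lambda>a::real. {..a}) \<subseteq> Pow UNIV"
      by simp
    moreover have "A \<in> sigma_sets UNIV (range (\<lambda>a::real. {..a}))"
      using that by (simp add: borel_eq_atMost)
    ultimately show ?thesis
    proof (induction rule: sigma_sets_induct_disjoint)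
      case (basic A)
      then show ?case
        using J_atMost by auto
    next
      case empty
      show ?case
        by (simp add: J_def set_lebesgue_integral_def)
    next
      case (compl A)
      then have A: "A \<in> sets borel"
        by (simp add: borel_eq_atMost)
      have "J (UNIV - A) = (\<integral>x. f x - indicator (A \<inter> space \<mu>) x *\<^sub>R f x \<partial>\<mu>)"
        unfolding J_def set_lebesgue_integral_def
        by (intro Bochner_Integration.integral_cong) (auto simp: indicator_def)
      also have "\<dots> = (\<integral>x. f x \<partial>\<mu>) - J A"
        using si[OF A] fi by (simp add: J_def set_lebesgue_integral_def set_integrable_def)
      \<comment> \<open>The integral over the whole space is the moment of order 0.\<close>
      also have "\<dots> = 0"
        using zero[of 0] compl by (simp add: moment_def)
      finally show ?case .
    next
      case (union A)
      then have A: "A i \<in> sets borel" for i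
        by (auto simp: borel_eq_atMost)
      have "J (\<Union>i. A i) = (LINT x:(\<Union>i. A i \<inter> space \<mu>)|\<mu>. f x)"
        unfolding J_def by (intro arg_cong[where f = "\<lambda>B. set_lebesgue_integral \<mu> B f"]) auto
      also have "\<dots> = (\<Sum>i. J (A i))"
        unfolding J_def
      proof (rule lebesgue_integral_countable_add)
        show "A i \<inter> space \<mu> \<in> sets \<mu>" for i
          by (rule sets[OF A])
        show "(A i \<inter> space \<mu>) \<inter> (A j \<inter> space \<mu>) = {}" if "i \<noteq> j" for i j
          using union(1) that by (auto simp: disjoint_family_on_def)
        have "(\<Union>i. A i) \<in> sets borel"
          using A by auto
        from si[OF this] show "set_integrable \<mu> (\<Union>i. A i \<inter> space \<mu>) f"
          by (simp add: Int_UN_distrib2)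
      qed
      also have "\<dots> = 0"
        using union by simp
      finally show ?case .
    qed
  qed
  show "set_lebesgue_integral \<mu> A f = 0" if "A \<in> sets \<mu>" for A
  proof -
    obtain A' where A': "A' \<in> sets borel" "A = A' \<inter> space \<mu>"
      using \<open>A \<in> sets \<mu>\<close> unfolding sets_eq circle_borel_def space_eq by (auto simp: sets_restrict_space)
    then show ?thesis
      using J[of A'] by (simp add: J_def)
  qed
qed

end

text \<open>The analogue for Lebesgue measure is false: \<open>fourier_char (- 1)\<close> has
  vanishing nonnegative coefficients there. What excludes this here is that b is inner, through
  \<open>\<beta>_sums\<close>.\<close>

theorem (in clark) AE_eq_0_of_fourier_coeff:
  assumes f: "f \<in> L2 \<mu>" and zero: "\<And>n. fourier_coeff f (int n) = 0"
  shows "AE x in \<mu>. f x = 0"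
  by (rule AE_eq_0_of_moments[OF f], rule moment_eq_0[OF f], rule fourier_coeff_eq_0[OF f zero])

section \<open>Interpolation at the integers\<close>

context clark
begin

text \<open>Formal division by mu_plus loses nothing, as its constant coefficient is nonzero.
  Condition (ii) therefore prescribes the nonnegative Fourier coefficients of the boundary
  functions.\<close>

lemma fourier_coeff_eq_of_normalized_cauchy:
  assumes f: "f \<in> L2 \<mu>" and eq: "\<And>z. z \<in> ball 0 1 \<Longrightarrow> normalized_cauchy \<mu> f z = G z"
    and G: "fps_expansion G 0 = series_over_mu_plus \<mu> a"
  shows "fourier_coeff f (int n) = a n"
proof -
  have "\<forall>\<^sub>F z in nhds 0. normalized_cauchy \<mu> f z = G z"
    using eventually_ball_nhds_0 by eventually_elim (simp add: eq)
  then have "fps_expansion (normalized_cauchy \<mu> f) 0 = fps_expansion G 0"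
    by (rule fps_expansion_cong)
  then have "(\<lambda>n. fourier_coeff f (int n)) = a"
    unfolding G normalized_cauchy_fps[OF f] by (rule series_over_mu_plus_inject)
  then show ?thesis
    by (rule fun_cong)
qed

lemma L2_boundary:
  assumes "G \<in> model_space b"
  shows L2_boundary_L2: "L2_boundary \<mu> G \<in> L2 \<mu>"
    and normalized_cauchy_L2_boundary: "z \<in> ball 0 1 \<Longrightarrow> normalized_cauchy \<mu> (L2_boundary \<mu> G) z = G z"
proof -
  have "\<exists>f. f \<in> L2 \<mu> \<and> (\<forall>z\<in>ball 0 1. normalized_cauchy \<mu> f z = G z)"
    using normalized_cauchy_surjective[OF assms] by metis
  then have "L2_boundary \<mu> G \<in> L2 \<mu> \<and> (\<forall>z\<in>ball 0 1. normalized_cauchy \<mu> (L2_boundary \<mu> G) z = G z)"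
    unfolding L2_boundary_def by (rule someI_ex)
  then show "L2_boundary \<mu> G \<in> L2 \<mu>"
    "z \<in> ball 0 1 \<Longrightarrow> normalized_cauchy \<mu> (L2_boundary \<mu> G) z = G z"
    by auto
qed

text \<open>The chosen representative and f have the same nonnegative coefficients, so injectivity
  identifies them up to a null set, which is the sense of equality in (iii).\<close>

lemma L2_boundary_normalized_cauchy:
  assumes f: "f \<in> L2 \<mu>"
  shows "AE x in \<mu>. L2_boundary \<mu> (normalized_cauchy \<mu> f) x = f x"
proof -
  define g where "g = L2_boundary \<mu> (normalized_cauchy \<mu> f)"
  note V = normalized_cauchy_in_model_space[OF f]
  have g: "g \<in> L2 \<mu>"
    unfolding g_def by (rule L2_boundary_L2[OF V])
  have "fourier_coeff g (int n) = fourier_coeff f (int n)" for n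
    by (rule fourier_coeff_eq_of_normalized_cauchy[OF g _ normalized_cauchy_fps[OF f]])
      (simp add: g_def normalized_cauchy_L2_boundary[OF V])
  then have "fourier_coeff (\<lambda>x. g x - f x) (int n) = 0" for n
    using integrable_mult_fourier_char[OF f] integrable_mult_fourier_char[OF g]
    by (simp add: fourier_coeff_def left_diff_distrib)
  from AE_eq_0_of_fourier_coeff[OF L2_diff[OF g f] this] show ?thesis
    by (simp add: g_def)
qed

lemma fourier_coeff_cnj: "fourier_coeff (\<lambda>x. cnj (f x)) n = cnj (fourier_coeff f (- n))"
  using Bochner_Integration.integral_cnj[of \<mu> "\<lambda>x. f x * fourier_char n x"]
  by (simp add: fourier_coeff_def del: Bochner_Integration.integral_cnj)

end

theorem theorem3:
  fixes \<mu> :: "real measure" and b :: "complex \<Rightarrow> complex" and F :: "complex \<Rightarrow> complex"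
  assumes "prob_space \<mu>" and "sets \<mu> = sets circle_borel" and "singular_to_lebesgue \<mu>"
    and "herglotz_inner \<mu> b"
    and "F holomorphic_on UNIV"
  shows
    "(\<exists>f\<in>L2 \<mu>. \<forall>z. F z = (\<integral>x. f x * exp (- 2 * of_real pi * \<i> * of_real x * z) \<partial>\<mu>)) \<longleftrightarrow>
     ((\<exists>\<epsilon> :: real \<Rightarrow> real. (\<forall>r\<ge>0. 0 \<le> \<epsilon> r) \<and> (\<epsilon> \<longlongrightarrow> 0) at_top \<and>
          (\<forall>z. norm (F z) \<le> \<epsilon> (norm z) * exp (pi * norm z))) \<and>
      (\<exists>G\<^sub>p\<in>model_space b. \<exists>G\<^sub>m\<in>model_space b.
          fps_expansion G\<^sub>p 0 = series_over_mu_plus \<mu> (\<lambda>n. F (of_nat n)) \<and>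
          fps_expansion G\<^sub>m 0 = series_over_mu_plus \<mu> (\<lambda>n. cnj (F (- of_nat n))) \<and>
          (AE x in \<mu>. cnj (L2_boundary \<mu> G\<^sub>p x) = L2_boundary \<mu> G\<^sub>m x)))"
    (is "?transform \<longleftrightarrow> ?growth \<and> ?interpolation")
proof -
  interpret clark \<mu> b
    using assms by (intro clark.intro circle_probability.intro clark_axioms.intro)
  show ?thesis
  proof
    assume ?transform
    then obtain f where f: "f \<in> L2 \<mu>" and F: "\<And>z. F z = fourier_transform f z"
      by (auto simp: fourier_transform_def)
    have f': "(\<lambda>x. cnj (f x)) \<in> L2 \<mu>"
      by (rule L2_cnj[OF f])
    have ?growth
      using fourier_transform_bound[OF f] unfolding F by metis
    \<comment> \<open>The witnesses are the transforms of f and of its conjugate; the nonnegative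
      coefficients of the conjugate are the conjugates of the coefficients of f at the nonpositive
      integers.\<close>
    moreover have ?interpolation
    proof (intro bexI conjI)
      show "fps_expansion (normalized_cauchy \<mu> f) 0 = series_over_mu_plus \<mu> (\<lambda>n. F (of_nat n))"
        using fourier_transform_of_int[of f "int n" for n] by (simp add: normalized_cauchy_fps[OF f] F)
      show "fps_expansion (normalized_cauchy \<mu> (\<lambda>x. cnj (f x))) 0
          = series_over_mu_plus \<mu> (\<lambda>n. cnj (F (- of_nat n)))"
        using fourier_transform_of_int[of f "- int n" for n]
        by (simp add: normalized_cauchy_fps[OF f'] F fourier_coeff_cnj)
      show "AE x in \<mu>. cnj (L2_boundary \<mu> (normalized_cauchy \<mu> f) x)
          = L2_boundary \<mu> (normalized_cauchy \<mu> (\<lambda>x. cnj (f x))) x"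
        using L2_boundary_normalized_cauchy[OF f] L2_boundary_normalized_cauchy[OF f']
        by eventually_elim simp
    qed (intro normalized_cauchy_in_model_space f f')+
    ultimately show "?growth \<and> ?interpolation" ..
  next
    assume "?growth \<and> ?interpolation"
    then obtain \<epsilon> Gp Gm where \<epsilon>: "(\<epsilon> \<longlongrightarrow> 0) at_top" "\<And>z. norm (F z) \<le> \<epsilon> (norm z) * exp (pi * norm z)"
      and Gp: "Gp \<in> model_space b" "fps_expansion Gp 0 = series_over_mu_plus \<mu> (\<lambda>n. F (of_nat n))"
      and Gm: "Gm \<in> model_space b" "fps_expansion Gm 0 = series_over_mu_plus \<mu> (\<lambda>n. cnj (F (- of_nat n)))"
      and cnj: "AE x in \<mu>. cnj (L2_boundary \<mu> Gp x) = L2_boundary \<mu> Gm x"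
      by auto
    define f where "f = L2_boundary \<mu> Gp"
    define g where "g = L2_boundary \<mu> Gm"
    have f: "f \<in> L2 \<mu>" and g: "g \<in> L2 \<mu>"
      unfolding f_def g_def by (intro L2_boundary_L2 Gp Gm)+
    have fn: "fourier_coeff f (int n) = F (of_nat n)" for n
      by (rule fourier_coeff_eq_of_normalized_cauchy[OF f _ Gp(2)])
        (simp add: f_def normalized_cauchy_L2_boundary[OF Gp(1)])
    have gn: "fourier_coeff g (int n) = cnj (F (- of_nat n))" for n
      by (rule fourier_coeff_eq_of_normalized_cauchy[OF g _ Gm(2)])
        (simp add: g_def normalized_cauchy_L2_boundary[OF Gm(1)])
    \<comment> \<open>Condition (iii) enters here: since g is the conjugate of f almost everywhere,
      its nonnegative coefficients determine those of f at the nonpositive integers.\<close>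
    have "fourier_coeff g n = fourier_coeff (\<lambda>x. cnj (f x)) n" for n
      unfolding fourier_coeff_def
    proof (rule integral_cong_AE)
      show "AE x in \<mu>. g x * fourier_char (- n) x = cnj (f x) * fourier_char (- n) x"
        using cnj by eventually_elim (simp add: f_def g_def)
    qed (use integrable_mult_fourier_char[OF g] integrable_mult_fourier_char[OF L2_cnj[OF f]] in auto)
    then have fm: "fourier_coeff f (- int n) = F (- of_nat n)" for n
      using gn[of n] by (simp add: fourier_coeff_cnj)
    have F_int: "F (of_int n) = fourier_transform f (of_int n)" for n :: int
      unfolding fourier_transform_of_int using fn[of "nat n"] fm[of "nat (- n)"]
      by (cases "n \<ge> 0") auto
    obtain \<delta> where \<delta>: "(\<delta> \<longlongrightarrow> 0) at_top"
      "\<And>z. norm (fourier_transform f z) \<le> \<delta> (norm z) * exp (pi * norm z)"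
      using fourier_transform_bound[OF f] by metis
    have "F z - fourier_transform f z = 0" for z
    proof (rule carlson[where H = "\<lambda>z. F z - fourier_transform f z" and \<epsilon> = "\<lambda>r. \<epsilon> r + \<delta> r"])
      show "(\<lambda>z. F z - fourier_transform f z) holomorphic_on UNIV"
        by (intro holomorphic_intros assms fourier_transform_holomorphic f)
      show "((\<lambda>r. \<epsilon> r + \<delta> r) \<longlongrightarrow> 0) at_top"
        using tendsto_add[OF \<epsilon>(1) \<delta>(1)] by simp
      show "norm (F z - fourier_transform f z) \<le> (\<epsilon> (norm z) + \<delta> (norm z)) * exp (pi * norm z)" for z
        using norm_triangle_ineq4[of "F z" "fourier_transform f z"] \<epsilon>(2)[of z] \<delta>(2)[of z]
        unfolding distrib_right by linarith
    qed (simp add: F_int)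
    then have "F z = fourier_transform f z" for z
      by simp
    with f show ?transform
      unfolding fourier_transform_def by blast
  qed
qed

end
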